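(* Fix a permutation $p:\mathbb N\to\mathbb N$, $n\mapsto n'$. Let $r_n\in[0,1]$, $n\ge1$, and let $w_n=r_ne^{iq_n}\in D$, where the phases $q_n$ are independent and uniformly distributed random angles. Then, almost surely, the sequence $\frac1{2\pi}d\Sigma_N$ has a unique weak$^*$ limit in $\mathrm{Prob}(S^1)$.
   Context: $D=\{|z|\le1\}$ is the closed unit disk. For $w_n=r_ne^{iq_n}\in D$ define $\Phi_n(w_n):\mathbb R\to\mathbb R$ by $$\Phi_n(w_n;\theta)=\theta-\frac2n\arctan\left(\frac{r_n\sin(n\theta+q_n)}{1+r_n\cos(n\theta+q_n)}\right)$$ when the denominator is nonzero, extended to all $\theta\in\mathbb R$ by right continuity (the extension is only needed when $r_n=1$, in which case $\Phi_n$ is a step function). Each $\Phi_n(w_n)$ is nondecreasing, right continuous and satisfies $\Phi_n(\theta+2\pi)=\Phi_n(\theta)+2\pi$. Put $\Sigma_N=\Phi_{N'}(w_{N'})\circ\cdots\circ\Phi_{1'}(w_{1'})$. The normalized distributional derivative $\frac1{2\pi}d\Sigma_N$ is regarded as a probability measure on $S^1=\mathbb R/2\pi\mathbb Z$. $\mathrm{Prob}(S^1)$ is the (compact) convex set of probability measures on $S^1$ with the weak$^*$ topology relative to $C^0(S^1)$. A weak$^*$ limit of the sequence means the weak$^*$ limit of a subsequence; since $\mathrm{Prob}(S^1)$ is compact and metrizable, uniqueness means that the sequence converges. *)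

theory Defs
  imports "HOL-Probability.Probability" "HOL-Real_Asymp.Real_Asymp"
begin

definition Phi_arctan :: "nat \<Rightarrow> complex \<Rightarrow> real \<Rightarrow> real" where
  "Phi_arctan n w \<theta> =
     \<theta> - 2 / real n * arctan (cmod w * sin (real n * \<theta> + Arg w) / (1 + cmod w * cos (real n * \<theta> + Arg w)))"

text \<open>Where the denominator vanishes, the value is prescribed by right continuity.\<close>

definition Phi :: "nat \<Rightarrow> complex \<Rightarrow> real \<Rightarrow> real" where
  "Phi n w \<theta> =
     (if 1 + cmod w * cos (real n * \<theta> + Arg w) \<noteq> 0 then Phi_arctan n w \<theta>
      else Lim (at_right \<theta>) (Phi_arctan n w))"

primrec Sigma_comp :: "(nat \<Rightarrow> nat) \<Rightarrow> (nat \<Rightarrow> complex) \<Rightarrow> nat \<Rightarrow> real \<Rightarrow> real" where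
  "Sigma_comp p w 0 = id"
| "Sigma_comp p w (Suc N) = Phi (p (Suc N)) (w (p (Suc N))) \<circ> Sigma_comp p w N"

text \<open>
  The group of reals modulo \<open>2\<pi>\<close> is modelled by the complex unit circle, with \<open>cis\<close> as the
  quotient map.
\<close>

definition circle_borel :: "complex measure" where
  "circle_borel = restrict_space borel (sphere 0 1)"

text \<open>
  If \<open>F\<close> is nondecreasing and right continuous with \<open>F (\<theta> + 2\<pi>) = F \<theta> + 2\<pi>\<close>, its distributional
  derivative is the Stieltjes measure \<open>interval_measure F\<close>. This measure is \<open>2\<pi>\<close>-periodic, so
  the measure it induces on the circle is the image of its restriction to the half-open
  fundamental domain \<open>{0<..2\<pi>}\<close>.
\<close>

definition normalized_deriv :: "(real \<Rightarrow> real) \<Rightarrow> complex measure" where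
  "normalized_deriv F =
     scale_measure (ennreal (1 / (2 * pi)))
       (distr (restrict_space (interval_measure F) {0<..2 * pi}) circle_borel cis)"

definition weak_star_topology :: "complex measure topology" where
  "weak_star_topology =
     topology_generated_by
       {{\<mu> \<in> space (prob_algebra circle_borel). (\<integral>z. f z \<partial>\<mu>) \<in> U} |f (U :: real set).
          continuous_on (sphere 0 1) f \<and> open U}"

text \<open>A weak* limit of a sequence is, by convention, a limit of some subsequence.\<close>

definition weak_star_limit :: "(nat \<Rightarrow> complex measure) \<Rightarrow> complex measure \<Rightarrow> bool" where
  "weak_star_limit \<sigma> \<mu> \<longleftrightarrow>
     (\<exists>k. strict_mono k \<and> limitin weak_star_topology (\<lambda>j. \<sigma> (k j)) \<mu> sequentially)"


text \<open>The choice of the argument in \<open>Phi\<close> is immaterial.\<close>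

lemma polar_eq:
  assumes "r \<ge> 0"
  shows "cmod (rcis r q) * sin (x + Arg (rcis r q)) = r * sin (x + q)"
    and "cmod (rcis r q) * cos (x + Arg (rcis r q)) = r * cos (x + q)"
proof -
  have *: "rcis (cmod (rcis r q)) (x + Arg (rcis r q)) = rcis r (x + q)"
    using rcis_mult[of 1 x "cmod (rcis r q)" "Arg (rcis r q)"] rcis_mult[of 1 x r q]
    by (simp only: rcis_cmod_Arg mult_1)
  show "cmod (rcis r q) * sin (x + Arg (rcis r q)) = r * sin (x + q)"
    using arg_cong[OF *, of Im] by simp
  show "cmod (rcis r q) * cos (x + Arg (rcis r q)) = r * cos (x + q)"
    using arg_cong[OF *, of Re] by simp
qed

lemma Phi_arctan_rcis:
  assumes "r \<ge> 0"
  shows "Phi_arctan n (rcis r q) \<theta> =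
    \<theta> - 2 / real n * arctan (r * sin (real n * \<theta> + q) / (1 + r * cos (real n * \<theta> + q)))"
  by (simp only: Phi_arctan_def polar_eq[OF assms])

lemma Phi_rcis:
  assumes "r \<ge> 0" "1 + r * cos (real n * \<theta> + q) \<noteq> 0"
  shows "Phi n (rcis r q) \<theta> =
    \<theta> - 2 / real n * arctan (r * sin (real n * \<theta> + q) / (1 + r * cos (real n * \<theta> + q)))"
  using assms(2) by (simp only: Phi_def polar_eq[OF assms(1)] Phi_arctan_rcis[OF assms(1)] if_True simp_thms)

lemma Phi_singular:
  assumes w: "cmod w \<le> 1" and n: "n \<ge> 1" and sing: "1 + cmod w * cos (real n * \<theta> + Arg w) = 0"
  shows "Phi n w \<theta> = \<theta> + pi / real n"
    and "(Phi_arctan n w \<longlongrightarrow> \<theta> + pi / real n) (at_right \<theta>)"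
proof -
  define c where "c = cos (real n * \<theta> + Arg w)"
  have c: "\<bar>c\<bar> \<le> 1" "cmod w * c = -1" using sing by (auto simp: c_def)
  have "1 = cmod w * \<bar>c\<bar>" using c(2) by (metis abs_minus abs_mult abs_norm_cancel abs_one)
  also have "\<dots> \<le> cmod w" using c(1) by (simp add: mult_left_le)
  finally have cw: "cmod w = 1" using w by simp
  then have cos: "cos (real n * \<theta> + Arg w) = -1" using c(2) c_def by simp
  then have sin: "sin (real n * \<theta> + Arg w) = 0"
    using sin_cos_squared_add[of "real n * \<theta> + Arg w"] by simp
  have shift: "Phi_arctan n w (\<theta> + t) =
      \<theta> + t + 2 / real n * arctan (sin (real n * t) / (1 - cos (real n * t)))" for t
  proof -
    have e: "real n * (\<theta> + t) + Arg w = (real n * \<theta> + Arg w) + real n * t"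
      by (simp add: algebra_simps)
    show ?thesis
      unfolding Phi_arctan_def e sin_add[of "real n * \<theta> + Arg w"] cos_add[of "real n * \<theta> + Arg w"]
      by (simp add: cos sin cw arctan_minus)
  qed
  have "real n > 0" using n by simp
  then have "((\<lambda>t. \<theta> + t + 2 / real n * arctan (sin (real n * t) / (1 - cos (real n * t))))
      \<longlongrightarrow> \<theta> + 2 / real n * (pi / 2)) (at_right 0)"
    by real_asymp
  then have "((\<lambda>t. Phi_arctan n w (\<theta> + t)) \<longlongrightarrow> \<theta> + pi / real n) (at_right 0)"
    by (simp add: shift)
  then show lim: "(Phi_arctan n w \<longlongrightarrow> \<theta> + pi / real n) (at_right \<theta>)"
    by (subst at_right_to_0) (simp add: filterlim_filtermap add.commute)
  show "Phi n w \<theta> = \<theta> + pi / real n"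
    using tendsto_Lim[OF _ lim] sing by (simp add: Phi_def trivial_limit_at_right_real)
qed

lemma topspace_weak_star_topology: "topspace weak_star_topology = space (prob_algebra circle_borel)"
proof -
  have "space (prob_algebra circle_borel) \<in>
      {{\<mu> \<in> space (prob_algebra circle_borel). (\<integral>z. f z \<partial>\<mu>) \<in> U} |f (U :: real set).
          continuous_on (sphere 0 1) f \<and> open U}"
    by (auto intro!: exI[of _ "\<lambda>_. 0"] exI[of _ UNIV])
  then show ?thesis
    unfolding weak_star_topology_def topology_generated_by_topspace by blast
qed

lemma limitin_weak_star_topology_iff:
  assumes \<sigma>: "\<And>n. \<sigma> n \<in> space (prob_algebra circle_borel)"
  shows "limitin weak_star_topology \<sigma> \<mu> F \<longleftrightarrow>
    \<mu> \<in> space (prob_algebra circle_borel) \<and>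
    (\<forall>f :: complex \<Rightarrow> real. continuous_on (sphere 0 1) f \<longrightarrow>
       ((\<lambda>n. \<integral>z. f z \<partial>\<sigma> n) \<longlongrightarrow> (\<integral>z. f z \<partial>\<mu>)) F)"
    (is "?L \<longleftrightarrow> ?R")
proof
  assume L: ?L
  have "((\<lambda>n. \<integral>z. f z \<partial>\<sigma> n) \<longlongrightarrow> (\<integral>z. f z \<partial>\<mu>)) F"
    if f: "continuous_on (sphere 0 1) f" for f :: "complex \<Rightarrow> real"
  proof (rule topological_tendstoI)
    fix U :: "real set" assume U: "open U" "(\<integral>z. f z \<partial>\<mu>) \<in> U"
    have "openin weak_star_topology {\<mu> \<in> space (prob_algebra circle_borel). (\<integral>z. f z \<partial>\<mu>) \<in> U}"
      unfolding weak_star_topology_def using f U by (intro topology_generated_by_Basis) blast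
    moreover have "\<mu> \<in> space (prob_algebra circle_borel)"
      using L topspace_weak_star_topology by (auto simp: limitin_def)
    ultimately have "\<forall>\<^sub>F n in F. \<sigma> n \<in> {\<mu> \<in> space (prob_algebra circle_borel). (\<integral>z. f z \<partial>\<mu>) \<in> U}"
      using L U unfolding limitin_def by blast
    then show "\<forall>\<^sub>F n in F. (\<integral>z. f z \<partial>\<sigma> n) \<in> U" by (rule eventually_mono) simp
  qed
  then show ?R using L topspace_weak_star_topology by (auto simp: limitin_def)
next
  assume R: ?R
  have "\<forall>\<^sub>F n in F. \<sigma> n \<in> V"
    if "generate_topology_on
          {{\<mu> \<in> space (prob_algebra circle_borel). (\<integral>z. f z \<partial>\<mu>) \<in> U} |f (U :: real set).
             continuous_on (sphere 0 1) f \<and> open U} V" "\<mu> \<in> V" for V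
    using that
  proof (induction rule: generate_topology_on.induct)
    case (Int a b)
    then show ?case by (auto intro: eventually_conj)
  next
    case (UN K)
    then obtain k where "k \<in> K" "\<mu> \<in> k" by blast
    with UN have "\<forall>\<^sub>F n in F. \<sigma> n \<in> k" by blast
    then show ?case by (rule eventually_mono) (use \<open>k \<in> K\<close> in blast)
  next
    case (Basis s)
    then obtain f and U :: "real set"
      where s: "s = {\<mu> \<in> space (prob_algebra circle_borel). (\<integral>z. f z \<partial>\<mu>) \<in> U}"
        and f: "continuous_on (sphere 0 1) f" and U: "open U" by blast
    from R f have "((\<lambda>n. \<integral>z. f z \<partial>\<sigma> n) \<longlongrightarrow> (\<integral>z. f z \<partial>\<mu>)) F" by blast
    then have "\<forall>\<^sub>F n in F. (\<integral>z. f z \<partial>\<sigma> n) \<in> U"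
      using U Basis s by (auto dest: topological_tendstoD)
    then show ?case using \<sigma> s by simp
  qed simp
  then show ?L
    using R unfolding limitin_def topspace_weak_star_topology
    by (simp add: weak_star_topology_def openin_topology_generated_by_iff)
qed

end

theory Submission
  imports Defs
begin

text \<open>
  The key is that \<open>\<Sigma>\<^sub>N(\<theta>)\<close> is, for each fixed \<open>\<theta>\<close>, a martingale bounded in \<open>L\<^sup>2\<close>.  The displacement
  \<open>\<Phi>\<^sub>n(\<theta>) - \<theta>\<close> is \<open>1/n\<close> times an essentially odd \<open>2\<pi>\<close>-periodic function of \<open>n\<theta> + q\<^sub>n\<close>, so
  averaging over a uniform phase \<open>q\<^sub>n\<close> gives \<open>0\<close>, whatever \<open>\<theta>\<close> is
  (\<open>mean_mobius_lift_displacement\<close>).  Since the phase used in step \<open>N + 1\<close> is independent of the phases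
  that determine \<open>\<Sigma>\<^sub>N(\<theta>)\<close>, the increments are conditionally centred
  (\<open>expectation_conditionally_centred\<close>).  They are bounded by \<open>\<pi>/n'\<close>, and a permutation does not
  affect the convergence of \<open>\<Sum> 1/n\<^sup>2\<close>; hence the martingale converges almost surely
  (\<open>AE_convergent_Sigma_comp\<close>).

  Almost surely this holds simultaneously at all rational multiples of \<open>2\<pi>\<close>.  There the
  nondecreasing functions \<open>\<Sigma>\<^sub>N\<close> converge, so the Riemann-Stieltjes sums of any continuous function
  over equidistant partitions converge.  These sums approximate the integrals uniformly in \<open>N\<close>,
  because every \<open>\<Sigma>\<^sub>N\<close> has total increase \<open>2\<pi>\<close> over a period; thus the integrals of every
  continuous function converge (\<open>convergent_lift_integral\<close>).  Therefore all subsequential limits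
  assign the same integrals to continuous functions and coincide, and one such limit exists by
  Helly's selection theorem (\<open>unique_weak_star_limit\<close>).
\<close>

section \<open>The maps \<open>\<Phi>\<^sub>n\<close> as lifts of Moebius transformations\<close>

text \<open>
  For \<open>0 \<le> r < 1\<close> this is the lift to \<open>\<real>\<close> of the transformation \<open>z \<mapsto> (z + r) / (1 + r z)\<close> of the unit
  circle, because that quotient is \<open>z\<close> times the conjugate of \<open>1 + r z\<close> over \<open>1 + r z\<close>.  The first
  branch is the limit from the right at the zeros of the denominator, which for \<open>r \<in> [0, 1]\<close> occur
  only when \<open>r = 1\<close>.
\<close>

definition mobius_lift :: "real \<Rightarrow> real \<Rightarrow> real" where
  "mobius_lift r u =
     (if 1 + r * cos u = 0 then u + pi else u - 2 * arctan (r * sin u / (1 + r * cos u)))"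

text \<open>
  Conjugating by \<open>\<theta> \<mapsto> n\<theta> + q\<close> removes the frequency and the phase, so that only the one-parameter
  family \<open>mobius_lift r\<close> has to be studied.
\<close>

lemma Phi_eq_mobius_lift:
  assumes r: "r \<in> {0..1}" and n: "n \<ge> 1"
  shows "Phi n (rcis r q) \<theta> = (mobius_lift r (real n * \<theta> + q) - q) / real n"
proof (cases "1 + r * cos (real n * \<theta> + q) = 0")
  case True
  then have "1 + cmod (rcis r q) * cos (real n * \<theta> + Arg (rcis r q)) = 0"
    using polar_eq(2)[of r q "real n * \<theta>"] r by auto
  then have "Phi n (rcis r q) \<theta> = \<theta> + pi / real n"
    using r n by (intro Phi_singular) auto
  then show ?thesis using True n by (simp add: mobius_lift_def field_simps)
next
  case False
  then show ?thesis using r n by (simp add: Phi_rcis mobius_lift_def field_simps)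
qed

lemma mobius_lift_periodic: "mobius_lift r (u + 2 * pi) = mobius_lift r u + 2 * pi"
  by (simp add: mobius_lift_def)

lemma mobius_lift_periodic_nat:
  "mobius_lift r (u + 2 * pi * real n) = mobius_lift r u + 2 * pi * real n"
proof (induction n)
  case (Suc n)
  have "mobius_lift r (u + 2 * pi * real (Suc n)) = mobius_lift r ((u + 2 * pi * real n) + 2 * pi)"
    by (simp add: algebra_simps)
  then show ?case by (simp only: mobius_lift_periodic Suc.IH) (simp add: algebra_simps)
qed simp

lemma mobius_lift_displacement_le: "\<bar>mobius_lift r u - u\<bar> \<le> pi"
  using arctan_bounded[of "r * sin u / (1 + r * cos u)"]
  by (auto simp: mobius_lift_def)

lemma one_plus_r_cos_pos:
  assumes "r \<in> {0..<1}" shows "1 + r * cos u > (0::real)"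
proof -
  have "\<bar>r * cos u\<bar> \<le> r"
    using assms abs_cos_le_one[of u] by (simp add: abs_mult mult_left_le)
  then show ?thesis using assms by auto
qed

text \<open>The derivative is the Poisson kernel, whence the monotonicity for \<open>r < 1\<close>.\<close>

lemma mobius_lift_has_derivative:
  assumes "r \<in> {0..<1}"
  shows "(mobius_lift r has_real_derivative
    (1 - r\<^sup>2) / ((1 + r * cos u)\<^sup>2 + (r * sin u)\<^sup>2)) (at u)"
proof -
  note pos = one_plus_r_cos_pos[OF assms]
  have nz: "1 + r * cos u \<noteq> 0" for u using pos[of u] by linarith
  have eq: "mobius_lift r = (\<lambda>u. u - 2 * arctan (r * sin u / (1 + r * cos u)))"
    by (simp add: fun_eq_iff mobius_lift_def nz)
  define a where "a = 1 + r * cos u"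
  define b where "b = r * sin u"
  have a: "a > 0" using pos a_def by simp
  have ab: "a\<^sup>2 + b\<^sup>2 > 0" using a by (intro add_pos_nonneg) auto
  have circ: "(a - 1)\<^sup>2 + b\<^sup>2 = r\<^sup>2"
    by (simp add: a_def b_def power_mult_distrib flip: distrib_left)
  have inv: "inverse (1 + (b / a)\<^sup>2) = a\<^sup>2 / (a\<^sup>2 + b\<^sup>2)"
    using a ab by (simp add: field_simps)
  have "inverse (1 + (b / a)\<^sup>2) * (((a - 1) * a - b * - b) / (a * a)) =
      ((a - 1) * a + b\<^sup>2) / (a\<^sup>2 + b\<^sup>2)"
    unfolding inv using a by (simp add: power2_eq_square)
  moreover have "1 - 2 * (((a - 1) * a + b\<^sup>2) / (a\<^sup>2 + b\<^sup>2)) = (1 - r\<^sup>2) / (a\<^sup>2 + b\<^sup>2)"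
  proof -
    have "1 - r\<^sup>2 = (a\<^sup>2 + b\<^sup>2) - 2 * ((a - 1) * a + b\<^sup>2)"
      unfolding circ[symmetric] by (simp add: power2_eq_square algebra_simps)
    moreover have "a\<^sup>2 + b\<^sup>2 \<noteq> 0" using ab by linarith
    ultimately show ?thesis by (simp only: diff_divide_distrib divide_self) simp
  qed
  ultimately have "(1 - r\<^sup>2) / (a\<^sup>2 + b\<^sup>2) =
      1 - 2 * (inverse (1 + (b / a)\<^sup>2) * (((a - 1) * a - b * - b) / (a * a)))"
    by simp
  then show ?thesis
    unfolding eq using nz
    by (auto intro!: derivative_eq_intros simp: a_def[symmetric] b_def[symmetric])
      (simp add: a_def b_def)
qed

text \<open>
  For \<open>r = 1\<close> the arctangent is \<open>arctan (tan (u / 2))\<close>, which is \<open>u / 2\<close> reduced modulo \<open>\<pi>\<close>.  What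
  remains is a step function, for which monotonicity and right continuity are visible.
\<close>

lemma mobius_lift_one_eq_floor:
  "mobius_lift 1 u = 2 * pi * of_int \<lfloor>(u + pi) / (2 * pi)\<rfloor>"
proof -
  define k where "k = \<lfloor>(u + pi) / (2 * pi)\<rfloor>"
  define v where "v = u - 2 * pi * of_int k"
  have "of_int k \<le> (u + pi) / (2 * pi)" "(u + pi) / (2 * pi) < of_int k + 1"
    unfolding k_def by linarith+
  then have v: "- pi \<le> v" "v < pi" by (auto simp: v_def field_simps)
  have u: "u = v + 2 * pi * of_int k" by (simp add: v_def)
  have sc: "sin u = sin v" "cos u = cos v"
    unfolding u by (simp_all add: sin_add cos_add)
  show ?thesis
  proof (cases "v = - pi")
    case True
    then show ?thesis using sc by (simp add: mobius_lift_def k_def[symmetric]) (simp add: u)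
  next
    case False
    then have v': "- (pi / 2) < v / 2" "v / 2 < pi / 2" using v by auto
    have "1 + cos v = 2 * (cos (v / 2))\<^sup>2"
      using cos_double_cos[of "v / 2"] by simp
    moreover have "cos (v / 2) > 0" using v' by (intro cos_gt_zero_pi) auto
    ultimately have nz: "1 + cos v \<noteq> 0" by simp
    have "arctan (sin v / (1 + cos v)) = v / 2"
      using tan_half[of "v / 2"] arctan_tan[OF v'] by (simp add: add.commute)
    then show ?thesis using nz sc by (simp add: mobius_lift_def k_def[symmetric]) (simp add: u)
  qed
qed

lemma mono_mobius_lift:
  assumes "r \<in> {0..1}" shows "mono (mobius_lift r)"
proof (cases "r = 1")
  case True
  then show ?thesis
    by (auto simp: mono_def mobius_lift_one_eq_floor intro!: floor_mono divide_right_mono)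
next
  case False
  then have r: "r \<in> {0..<1}" using assms by auto
  have "1 - r\<^sup>2 \<ge> 0" using r by (simp add: power_le_one)
  show ?thesis
  proof (rule monoI)
    fix x y :: real assume "x \<le> y"
    then show "mobius_lift r x \<le> mobius_lift r y"
    proof (rule DERIV_nonneg_imp_nondecreasing)
      fix u
      have "(1 - r\<^sup>2) / ((1 + r * cos u)\<^sup>2 + (r * sin u)\<^sup>2) \<ge> 0"
        using \<open>1 - r\<^sup>2 \<ge> 0\<close> by (intro divide_nonneg_nonneg) auto
      then show "\<exists>d. DERIV (mobius_lift r) u :> d \<and> d \<ge> 0"
        using mobius_lift_has_derivative[OF r] by blast
    qed
  qed
qed

lemma right_continuous_mobius_lift:
  assumes "r \<in> {0..1}" shows "continuous (at_right u) (mobius_lift r)"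
proof (cases "r = 1")
  case True
  define x where "x = (u + pi) / (2 * pi)"
  define d where "d = 2 * pi * (of_int \<lfloor>x\<rfloor> + 1 - x)"
  have "x < of_int \<lfloor>x\<rfloor> + 1" by linarith
  then have d: "d > 0" by (simp add: d_def)
  have "2 * pi * x = u + pi" by (simp add: x_def)
  then have ud: "u + d + pi = (of_int \<lfloor>x\<rfloor> + 1) * (2 * pi)"
    by (simp add: d_def algebra_simps)
  have "mobius_lift 1 y = mobius_lift 1 u" if y: "u < y" "y < u + d" for y
  proof -
    have "x \<le> (y + pi) / (2 * pi)"
      using y by (simp add: x_def divide_right_mono)
    moreover have "(y + pi) / (2 * pi) < of_int \<lfloor>x\<rfloor> + 1"
      using y ud by (subst pos_divide_less_eq) auto
    ultimately have "\<lfloor>(y + pi) / (2 * pi)\<rfloor> = \<lfloor>x\<rfloor>" by (intro floor_unique) linarith+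
    then show ?thesis by (simp add: mobius_lift_one_eq_floor x_def)
  qed
  then have "\<forall>\<^sub>F y in at_right u. mobius_lift 1 u = mobius_lift 1 y"
    using d by (auto simp: eventually_at_right_field intro!: exI[of _ "u + d"])
  then have "(mobius_lift 1 \<longlongrightarrow> mobius_lift 1 u) (at_right u)"
    by (rule Lim_transform_eventually[OF tendsto_const])
  then show ?thesis using True by (simp add: continuous_within)
next
  case False
  then have r: "r \<in> {0..<1}" using assms by auto
  show ?thesis
    by (rule continuous_at_imp_continuous_at_within)
      (rule DERIV_isCont[OF mobius_lift_has_derivative[OF r]])
qed

text \<open>
  The right continuous lifts of degree one: these properties make \<open>normalized_deriv F\<close> a
  probability measure, and they pass to compositions.
\<close>

definition circle_lift :: "(real \<Rightarrow> real) \<Rightarrow> bool" where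
  "circle_lift F \<longleftrightarrow> mono F \<and> (\<forall>a. continuous (at_right a) F) \<and> (\<forall>x. F (x + 2 * pi) = F x + 2 * pi)"

lemma right_continuous_comp_mono:
  fixes F G :: "real \<Rightarrow> real"
  assumes "mono F" "mono G" "\<And>a. continuous (at_right a) F" "\<And>a. continuous (at_right a) G"
  shows "continuous (at_right a) (F \<circ> G)"
proof -
  have mono: "mono (F \<circ> G)" using assms(1,2) by (auto simp: mono_def)
  have iff: "continuous (at_right b) H \<longleftrightarrow> (\<forall>\<epsilon>>0. \<exists>\<delta>>0. H (b + \<delta>) - H b < \<epsilon>)"
    if "mono H" for H :: "real \<Rightarrow> real" and b
    by (rule continuous_at_right_real_increasing) (rule monoD[OF that])
  show ?thesis
    unfolding iff[OF mono]
  proof (intro allI impI)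
    fix \<epsilon> :: real assume "\<epsilon> > 0"
    then obtain \<delta> where \<delta>: "\<delta> > 0" "F (G a + \<delta>) - F (G a) < \<epsilon>"
      using assms(3)[of "G a"] unfolding iff[OF assms(1)] by blast
    then obtain \<delta>' where \<delta>': "\<delta>' > 0" "G (a + \<delta>') - G a < \<delta>"
      using assms(4)[of a] unfolding iff[OF assms(2)] by blast
    have "F (G (a + \<delta>')) \<le> F (G a + \<delta>)" using \<delta>' by (intro monoD[OF assms(1)]) auto
    then show "\<exists>\<delta>>0. (F \<circ> G) (a + \<delta>) - (F \<circ> G) a < \<epsilon>"
      using \<delta> \<delta>' by (intro exI[of _ \<delta>']) auto
  qed
qed

lemma circle_lift_comp: "circle_lift F \<Longrightarrow> circle_lift G \<Longrightarrow> circle_lift (F \<circ> G)"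
  using right_continuous_comp_mono[of F G] by (auto simp: circle_lift_def mono_def)

lemma circle_lift_Phi:
  assumes r: "r \<in> {0..1}" and n: "n \<ge> 1"
  shows "circle_lift (Phi n (rcis r q))"
proof -
  have eq: "Phi n (rcis r q) = (\<lambda>x. (x - q) / real n) \<circ> (mobius_lift r \<circ> (\<lambda>\<theta>. real n * \<theta> + q))"
    using Phi_eq_mobius_lift[OF r n] by auto
  have m: "mono (\<lambda>x. (x - q) / real n)" "mono (\<lambda>\<theta>. real n * \<theta> + q)"
    using n by (auto simp: mono_def divide_right_mono)
  have m2: "mono (mobius_lift r \<circ> (\<lambda>\<theta>. real n * \<theta> + q))"
    using m mono_mobius_lift[OF r] by (auto simp: mono_def)
  have "continuous (at_right a) (Phi n (rcis r q))" for a
    unfolding eq using n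
    by (intro right_continuous_comp_mono m m2 mono_mobius_lift right_continuous_mobius_lift r
        continuous_intros) auto
  moreover have "mono (Phi n (rcis r q))"
    unfolding eq using m m2 by (auto simp: mono_def)
  moreover have "Phi n (rcis r q) (x + 2 * pi) = Phi n (rcis r q) x + 2 * pi" for x
  proof -
    have e: "real n * (x + 2 * pi) + q = (real n * x + q) + 2 * pi * real n"
      by (simp add: algebra_simps)
    show ?thesis
      unfolding Phi_eq_mobius_lift[OF r n] e mobius_lift_periodic_nat using n
      by (simp add: field_simps)
  qed
  ultimately show ?thesis by (simp add: circle_lift_def)
qed

section \<open>The mean displacement vanishes\<close>

text \<open>
  For \<open>a \<le> b\<close>, both \<open>[a, a + 2\<pi>) \<union> [a + 2\<pi>, b + 2\<pi>)\<close> and \<open>[a, b) \<union> [b, b + 2\<pi>)\<close> are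
  \<open>[a, b + 2\<pi>)\<close>, and by periodicity the integrals over \<open>[a + 2\<pi>, b + 2\<pi>)\<close> and \<open>[a, b)\<close> agree.
\<close>

lemma integral_periodic_window:
  fixes h :: "real \<Rightarrow> real"
  assumes h[measurable]: "h \<in> borel_measurable borel" and B: "\<And>x. \<bar>h x\<bar> \<le> B"
    and per: "\<And>x. h (x + 2 * pi) = h x"
  shows "(\<integral>x. indicator {a..<a + 2 * pi} x * h x \<partial>lborel) =
         (\<integral>x. indicator {b..<b + 2 * pi} x * h x \<partial>lborel)"
proof -
  have int: "integrable lborel (\<lambda>x. indicator {c..<d} x * h x)" for c d :: real
  proof -
    have "set_integrable lborel {c..<d} h"
      unfolding set_integrable_def
      by (rule integrableI_bounded_set[where A="{c..<d}" and B=B])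
        (use B emeasure_bounded_finite[of "{c..<d}"] in \<open>auto simp: indicator_def\<close>)
    then show ?thesis by (simp add: set_integrable_def)
  qed
  have *: "(\<integral>x. indicator {a..<a + 2 * pi} x * h x \<partial>lborel) =
         (\<integral>x. indicator {b..<b + 2 * pi} x * h x \<partial>lborel)" if ab: "a \<le> b" for a b :: real
  proof -
    have shift: "(\<integral>x. indicator {a + 2 * pi..<b + 2 * pi} x * h x \<partial>lborel) =
        (\<integral>x. indicator {a..<b} x * h x \<partial>lborel)"
      by (subst lborel_integral_real_affine[where c=1 and t="2 * pi"])
        (auto simp: indicator_def per add.commute intro!: Bochner_Integration.integral_cong)
    have "(\<integral>x. indicator {a..<a + 2 * pi} x * h x + indicator {a + 2 * pi..<b + 2 * pi} x * h x \<partial>lborel)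
        = (\<integral>x. indicator {a..<b} x * h x + indicator {b..<b + 2 * pi} x * h x \<partial>lborel)"
      by (rule Bochner_Integration.integral_cong[OF refl])
        (use ab in \<open>auto simp: indicator_def\<close>; use pi_gt_zero in linarith)
    then show ?thesis
      by (simp add: Bochner_Integration.integral_add int shift)
  qed
  show ?thesis using *[of a b] *[of b a] by linarith
qed

lemma borel_measurable_mobius_lift:
  assumes "r \<in> {0..1}" shows "mobius_lift r \<in> borel_measurable borel"
  by (intro borel_measurable_mono mono_mobius_lift assms)

text \<open>
  The displacement is odd off the zeros of the denominator, and these meet \<open>[-\<pi>, \<pi>]\<close> at most in
  its end points.
\<close>

lemma integral_mobius_lift_displacement:
  assumes r: "r \<in> {0..1}"
  shows "(\<integral>x. indicator {-pi..<pi} x * (mobius_lift r x - x) \<partial>lborel) = 0"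
proof -
  have [measurable]: "mobius_lift r \<in> borel_measurable borel"
    by (rule borel_measurable_mobius_lift[OF r])
  let ?f = "\<lambda>x. indicator {-pi..<pi} x * (mobius_lift r x - x)"
  have "AE x in lborel. x \<noteq> (-pi :: real)" "AE x in lborel. x \<noteq> (pi :: real)"
    by (rule AE_lborel_singleton)+
  then have odd: "AE x in lborel. ?f (- x) = - ?f x"
  proof eventually_elim
    case (elim x)
    show ?case
    proof (cases "x \<in> {-pi<..<pi}")
      case True
      have "cos (x / 2) > 0" using True by (intro cos_gt_zero_pi) auto
      then have c: "1 + cos x > 0"
        using cos_double_cos[of "x / 2"] by simp
      have "1 + r * cos x = (1 - r) + r * (1 + cos x)" by (simp add: algebra_simps)
      also have "\<dots> > 0"
        using r c by (cases "r = 1") (auto intro: add_pos_nonneg)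
      finally have "1 + r * cos x \<noteq> 0" by simp
      then show ?thesis using True by (simp add: mobius_lift_def arctan_minus)
    next
      case False
      then show ?thesis using elim by (auto simp: indicator_def)
    qed
  qed
  have "integral\<^sup>L lborel ?f = (\<integral>x. ?f (- x) \<partial>lborel)"
    by (subst lborel_integral_real_affine[where c="-1" and t=0]) auto
  also have "\<dots> = (\<integral>x. - ?f x \<partial>lborel)"
    by (rule integral_cong_AE) (use odd in auto)
  finally show ?thesis by simp
qed

lemma integral_uniform_measure_Ico:
  fixes g :: "real \<Rightarrow> real"
  assumes [measurable]: "g \<in> borel_measurable borel"
  shows "(\<integral>t. g t \<partial>uniform_measure lborel {0..<2 * pi}) =
    (\<integral>t. indicator {0..<2 * pi} t * g t \<partial>lborel) / (2 * pi)"
proof -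
  have "uniform_measure lborel {0..<2 * pi} =
      density lborel (\<lambda>t. ennreal (indicator {0..<2 * pi} t / (2 * pi)))"
    unfolding uniform_measure_def
    by (intro density_cong) (auto simp: indicator_def divide_ennreal[symmetric] ennreal_mult')
  then show ?thesis
    by (simp add: integral_density)
qed

text \<open>
  This is the source of the martingale property: a uniform phase moves no point on average.
\<close>

lemma mean_mobius_lift_displacement:
  assumes r: "r \<in> {0..1}"
  shows "(\<integral>t. mobius_lift r (s + t) - (s + t) \<partial>uniform_measure lborel {0..<2 * pi}) = 0"
proof -
  have m[measurable]: "mobius_lift r \<in> borel_measurable borel"
    by (rule borel_measurable_mobius_lift[OF r])
  let ?h = "\<lambda>x. mobius_lift r x - x"
  have "(\<integral>t. indicator {0..<2 * pi} t * ?h (s + t) \<partial>lborel) =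
      (\<integral>x. indicator {s..<s + 2 * pi} x * ?h x \<partial>lborel)"
    by (subst (2) lborel_integral_real_affine[where c=1 and t=s])
      (auto simp: indicator_def intro!: Bochner_Integration.integral_cong)
  also have "\<dots> = (\<integral>x. indicator {-pi..<-pi + 2 * pi} x * ?h x \<partial>lborel)"
    by (rule integral_periodic_window[where B=pi])
      (auto simp: mobius_lift_displacement_le mobius_lift_periodic)
  also have "\<dots> = 0" using integral_mobius_lift_displacement[OF r] by simp
  finally show ?thesis by (simp add: integral_uniform_measure_Ico)
qed

section \<open>Martingales with square summable increments\<close>

context prob_space
begin

text \<open>
  Independence makes the joint law of \<open>Z\<close> and \<open>Q\<close> a product, so that \<open>Q\<close> can be integrated out
  first, with \<open>Z\<close> frozen.
\<close>

lemma expectation_conditionally_centred: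
  fixes G :: "'b \<times> real \<Rightarrow> real" and N :: "'b measure"
  assumes sub: "subalgebra M F"
    and Z_F: "Z \<in> measurable F N" and Q[measurable]: "random_variable borel Q"
    and ind: "indep_set (sets F) {Q -` B \<inter> space M | B. B \<in> sets borel}"
    and G[measurable]: "G \<in> borel_measurable (N \<Otimes>\<^sub>M borel)"
    and int: "integrable M (\<lambda>\<omega>. G (Z \<omega>, Q \<omega>))"
    and zero: "\<And>z. z \<in> space N \<Longrightarrow> (\<integral>t. G (z, t) \<partial>distr M borel Q) = 0"
  shows "expectation (\<lambda>\<omega>. G (Z \<omega>, Q \<omega>)) = 0"
proof -
  have Z[measurable]: "random_variable N Z" by (rule measurable_from_subalg[OF sub Z_F])
  have space_F: "space F = space M" using sub by (simp add: subalgebra_def)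
  interpret DZ: prob_space "distr M N Z" by (rule prob_space_distr) simp
  interpret DQ: prob_space "distr M borel Q" by (rule prob_space_distr) simp
  interpret P: pair_prob_space "distr M N Z" "distr M borel Q" ..
  have joint: "distr M N Z \<Otimes>\<^sub>M distr M borel Q = distr M (N \<Otimes>\<^sub>M borel) (\<lambda>\<omega>. (Z \<omega>, Q \<omega>))"
  proof (rule pair_measure_eqI)
    fix A B assume "A \<in> sets (distr M N Z)" "B \<in> sets (distr M borel Q)"
    then have [measurable]: "A \<in> sets N" "B \<in> sets borel" by auto
    have "Z -` A \<inter> space M \<in> sets F"
      using measurable_sets[OF Z_F, of A] by (simp add: space_F)
    then have "prob ((Z -` A \<inter> space M) \<inter> (Q -` B \<inter> space M)) =
        prob (Z -` A \<inter> space M) * prob (Q -` B \<inter> space M)"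
      by (intro indep_setD[OF ind]) auto
    moreover have "(\<lambda>\<omega>. (Z \<omega>, Q \<omega>)) -` (A \<times> B) \<inter> space M =
        (Z -` A \<inter> space M) \<inter> (Q -` B \<inter> space M)"
      by auto
    ultimately show "emeasure (distr M N Z) A * emeasure (distr M borel Q) B =
        emeasure (distr M (N \<Otimes>\<^sub>M borel) (\<lambda>\<omega>. (Z \<omega>, Q \<omega>))) (A \<times> B)"
      by (simp add: emeasure_distr emeasure_eq_measure ennreal_mult)
  qed (auto intro: DZ.sigma_finite_measure_axioms DQ.sigma_finite_measure_axioms cong: sets_pair_measure_cong)
  have "expectation (\<lambda>\<omega>. G (Z \<omega>, Q \<omega>)) =
      (\<integral>x. G x \<partial>(distr M N Z \<Otimes>\<^sub>M distr M borel Q))"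
    unfolding joint by (subst integral_distr) auto
  also have "\<dots> = (\<integral>z. (\<integral>t. G (z, t) \<partial>distr M borel Q) \<partial>distr M N Z)"
  proof (rule P.integral_fst'[symmetric])
    show "integrable (distr M N Z \<Otimes>\<^sub>M distr M borel Q) G"
      unfolding joint using int by (subst integrable_distr_eq) auto
  qed
  also have "\<dots> = (\<integral>z. 0 \<partial>distr M N Z)"
    by (rule Bochner_Integration.integral_cong) (auto simp: zero)
  finally show ?thesis by simp
qed

end

text \<open>
  The last assumption is the martingale property in tested form: the increment after time \<open>k\<close> is
  orthogonal to every bounded function of the past up to time \<open>k\<close>.
\<close>

locale bounded_increment_martingale = prob_space M for M :: "'a measure" +
  fixes F :: "nat \<Rightarrow> 'a measure" and S :: "nat \<Rightarrow> 'a \<Rightarrow> real" and c :: "nat \<Rightarrow> real"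
  assumes sub: "\<And>k. subalgebra M (F k)"
    and filt: "\<And>k. subalgebra (F (Suc k)) (F k)"
    and adapted: "\<And>k. S k \<in> borel_measurable (F k)"
    and bd: "\<And>k \<omega>. \<omega> \<in> space M \<Longrightarrow> \<bar>S (Suc k) \<omega> - S k \<omega>\<bar> \<le> c k"
    and mart: "\<And>k Z B. Z \<in> borel_measurable (F k) \<Longrightarrow> (\<And>\<omega>. \<bar>Z \<omega>\<bar> \<le> B) \<Longrightarrow>
        expectation (\<lambda>\<omega>. Z \<omega> * (S (Suc k) \<omega> - S k \<omega>)) = 0"
begin

text \<open>
  Kolmogorov's inequality.  Stopping the process when it first leaves the \<open>\<epsilon>\<close>-neighbourhood of its
  value at time \<open>m\<close> gives a martingale that still records at time \<open>n\<close> whether this exit took place;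
  so Markov's inequality for its second moment at the single time \<open>n\<close> controls the maximum.
\<close>

lemma maximal_inequality:
  assumes \<epsilon>: "\<epsilon> > 0"
  shows "prob {\<omega> \<in> space M. \<exists>i\<le>n. \<bar>S (m + i) \<omega> - S m \<omega>\<bar> \<ge> \<epsilon>} \<le> (\<Sum>i<n. (c (m + i))\<^sup>2) / \<epsilon>\<^sup>2"
proof -
  \<comment> \<open>\<open>T\<close> is the process started at time \<open>m\<close> and stopped at the exit.\<close>
  define T where "T = rec_nat (\<lambda>_. 0)
    (\<lambda>j t \<omega>. t \<omega> + (if \<bar>t \<omega>\<bar> < \<epsilon> then S (Suc (m + j)) \<omega> - S (m + j) \<omega> else 0 :: real))"
  have T0: "T 0 \<omega> = 0" for \<omega> by (simp add: T_def)
  have TS: "T (Suc j) \<omega> = T j \<omega> + (if \<bar>T j \<omega>\<bar> < \<epsilon> then S (Suc (m + j)) \<omega> - S (m + j) \<omega> else 0)"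
    for j \<omega> by (simp add: T_def)
  have c0: "c k \<ge> 0" for k
    using bd[of _ k] not_empty by fastforce
  have S_M[measurable]: "S k \<in> borel_measurable M" for k
    by (rule measurable_from_subalg[OF sub adapted])
  have T_meas: "T j \<in> borel_measurable (F (m + j))" for j
  proof (induction j)
    case 0
    then show ?case by (simp add: T0[abs_def] T_def)
  next
    case (Suc j)
    have [measurable]: "T j \<in> borel_measurable (F (Suc (m + j)))"
      "S (m + j) \<in> borel_measurable (F (Suc (m + j)))"
      "S (Suc (m + j)) \<in> borel_measurable (F (Suc (m + j)))"
      using Suc adapted filt by (auto intro: measurable_from_subalg)
    show ?case by (simp add: TS[abs_def])
  qed
  have T_M[measurable]: "T j \<in> borel_measurable M" for j
    by (rule measurable_from_subalg[OF sub T_meas])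
  have T_bd: "\<bar>T j \<omega>\<bar> \<le> (\<Sum>i<j. c (m + i))" if "\<omega> \<in> space M" for j \<omega>
  proof (induction j)
    case (Suc j)
    then show ?case using bd[OF that, of "m + j"] c0[of "m + j"] by (auto simp: TS)
  qed (simp add: T0)
  have iT: "integrable M (\<lambda>\<omega>. (T k \<omega>)\<^sup>2)" for k
  proof (rule integrable_const_bound[where B="(\<Sum>i<k. c (m + i))\<^sup>2"])
    show "AE \<omega> in M. norm ((T k \<omega>)\<^sup>2) \<le> (\<Sum>i<k. c (m + i))\<^sup>2"
    proof (rule AE_I2)
      fix \<omega> assume "\<omega> \<in> space M"
      then have "\<bar>T k \<omega>\<bar> \<le> \<bar>\<Sum>i<k. c (m + i)\<bar>" by (rule order_trans[OF T_bd abs_ge_self])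
      then show "norm ((T k \<omega>)\<^sup>2) \<le> (\<Sum>i<k. c (m + i))\<^sup>2" by (simp add: abs_le_square_iff)
    qed
  qed simp
  have second: "expectation (\<lambda>\<omega>. (T j \<omega>)\<^sup>2) \<le> (\<Sum>i<j. (c (m + i))\<^sup>2)" for j
  proof (induction j)
    case (Suc j)
    \<comment> \<open>The cross term of \<open>(T j + increment)\<^sup>2\<close> is \<open>Z * X\<close>, whose mean vanishes.\<close>
    define Z where "Z \<omega> = (if \<bar>T j \<omega>\<bar> < \<epsilon> then 2 * T j \<omega> else 0)" for \<omega>
    define X where "X \<omega> = S (Suc (m + j)) \<omega> - S (m + j) \<omega>" for \<omega>
    have [measurable]: "X \<in> borel_measurable M" unfolding X_def by simp
    have T'[measurable]: "T j \<in> borel_measurable (F (m + j))" by (rule T_meas)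
    have Z_F: "Z \<in> borel_measurable (F (m + j))" unfolding Z_def by measurable
    have [measurable]: "Z \<in> borel_measurable M" by (rule measurable_from_subalg[OF sub Z_F])
    have Zb: "\<bar>Z \<omega>\<bar> \<le> 2 * \<epsilon>" for \<omega> using \<epsilon> by (auto simp: Z_def)
    have Xb: "\<bar>X \<omega>\<bar> \<le> c (m + j)" if "\<omega> \<in> space M" for \<omega> using bd[OF that] by (simp add: X_def)
    have ZX: "expectation (\<lambda>\<omega>. Z \<omega> * X \<omega>) = 0"
      unfolding X_def by (rule mart[OF Z_F Zb])
    have iZX: "integrable M (\<lambda>\<omega>. Z \<omega> * X \<omega>)"
      by (rule integrable_const_bound[where B="2 * \<epsilon> * c (m + j)"])
        (use Zb Xb \<epsilon> in \<open>auto simp: abs_mult intro!: mult_mono\<close>)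
    have "expectation (\<lambda>\<omega>. (T (Suc j) \<omega>)\<^sup>2) \<le>
        expectation (\<lambda>\<omega>. (T j \<omega>)\<^sup>2 + Z \<omega> * X \<omega> + (c (m + j))\<^sup>2)"
    proof (rule integral_mono)
      fix \<omega> assume "\<omega> \<in> space M"
      then have "(X \<omega>)\<^sup>2 \<le> (c (m + j))\<^sup>2"
        using Xb[of \<omega>] by (intro abs_le_square_iff[THEN iffD1]) auto
      then show "(T (Suc j) \<omega>)\<^sup>2 \<le> (T j \<omega>)\<^sup>2 + Z \<omega> * X \<omega> + (c (m + j))\<^sup>2"
        by (auto simp: TS Z_def X_def[symmetric] power2_sum)
    qed (use iT iZX in auto)
    also have "\<dots> = expectation (\<lambda>\<omega>. (T j \<omega>)\<^sup>2) + (c (m + j))\<^sup>2"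
      using iT iZX ZX by (simp add: prob_space)
    finally show ?case using Suc by simp
  qed (simp add: T0)
  have frozen: "T (i + k) \<omega> = T i \<omega>" if "\<bar>T i \<omega>\<bar> \<ge> \<epsilon>" for i k \<omega>
    using that by (induction k) (auto simp: TS)
  have before: "T i \<omega> = S (m + i) \<omega> - S m \<omega>" if "\<forall>l<i. \<bar>S (m + l) \<omega> - S m \<omega>\<bar> < \<epsilon>" for i \<omega>
    using that by (induction i) (auto simp: TS T0)
  have hit: "\<bar>T n \<omega>\<bar> \<ge> \<epsilon>" if "\<exists>i\<le>n. \<bar>S (m + i) \<omega> - S m \<omega>\<bar> \<ge> \<epsilon>" for \<omega>
  proof -
    define i where "i = (LEAST i. \<bar>S (m + i) \<omega> - S m \<omega>\<bar> \<ge> \<epsilon>)"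
    from that obtain i' where i': "i' \<le> n" "\<bar>S (m + i') \<omega> - S m \<omega>\<bar> \<ge> \<epsilon>" by blast
    have i: "\<bar>S (m + i) \<omega> - S m \<omega>\<bar> \<ge> \<epsilon>" unfolding i_def by (rule LeastI) (rule i'(2))
    have "i \<le> n" using i' Least_le[of "\<lambda>i. \<bar>S (m + i) \<omega> - S m \<omega>\<bar> \<ge> \<epsilon>" i'] by (simp add: i_def)
    have "\<bar>S (m + l) \<omega> - S m \<omega>\<bar> < \<epsilon>" if "l < i" for l
      using not_less_Least[of l "\<lambda>i. \<bar>S (m + i) \<omega> - S m \<omega>\<bar> \<ge> \<epsilon>"] that by (auto simp: i_def)
    then have "\<bar>T i \<omega>\<bar> \<ge> \<epsilon>" using before[of i \<omega>] i by simp
    then show ?thesis using frozen[of i \<omega> "n - i"] \<open>i \<le> n\<close> by simp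
  qed
  have "prob {\<omega> \<in> space M. \<exists>i\<le>n. \<bar>S (m + i) \<omega> - S m \<omega>\<bar> \<ge> \<epsilon>} \<le>
      prob {\<omega> \<in> space M. (T n \<omega>)\<^sup>2 \<ge> \<epsilon>\<^sup>2}"
  proof (rule finite_measure_mono)
    show "{\<omega> \<in> space M. (T n \<omega>)\<^sup>2 \<ge> \<epsilon>\<^sup>2} \<in> events" by measurable
    show "{\<omega> \<in> space M. \<exists>i\<le>n. \<epsilon> \<le> \<bar>S (m + i) \<omega> - S m \<omega>\<bar>} \<subseteq> {\<omega> \<in> space M. \<epsilon>\<^sup>2 \<le> (T n \<omega>)\<^sup>2}"
      using hit \<epsilon> by (auto simp: abs_le_square_iff[symmetric])
  qed
  also have "\<dots> \<le> expectation (\<lambda>\<omega>. (T n \<omega>)\<^sup>2) / \<epsilon>\<^sup>2"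
    by (rule integral_Markov_inequality_measure[where A="space M"]) (use \<epsilon> iT in auto)
  also have "\<dots> \<le> (\<Sum>i<n. (c (m + i))\<^sup>2) / \<epsilon>\<^sup>2"
    by (intro divide_right_mono second) auto
  finally show ?thesis .
qed

text \<open>
  By the maximal inequality, the probability of an oscillation of size \<open>\<epsilon>\<close> after time \<open>m\<close> is at
  most the tail \<open>\<Sum>k\<ge>m. (c k)\<^sup>2\<close> divided by \<open>\<epsilon>\<^sup>2\<close>, which tends to \<open>0\<close>; so the paths are almost
  surely Cauchy.
\<close>

theorem AE_convergent:
  assumes summ: "summable (\<lambda>k. (c k)\<^sup>2)"
  shows "AE \<omega> in M. convergent (\<lambda>k. S k \<omega>)"
proof -
  have [measurable]: "S k \<in> borel_measurable M" for k
    by (rule measurable_from_subalg[OF sub adapted])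
  define R where "R m = (\<Sum>i. (c (i + m))\<^sup>2)" for m
  have R: "R \<longlonglongrightarrow> 0" unfolding R_def by (rule suminf_exist_split2[OF summ])
  define E where "E \<epsilon> m = {\<omega> \<in> space M. \<exists>i. \<bar>S (m + i) \<omega> - S m \<omega>\<bar> \<ge> \<epsilon>}" for \<epsilon> m
  have [measurable]: "E \<epsilon> m \<in> events" for \<epsilon> m unfolding E_def by measurable
  have PE: "prob (E \<epsilon> m) \<le> R m / \<epsilon>\<^sup>2" if \<epsilon>: "\<epsilon> > 0" for \<epsilon> m
  proof (rule LIMSEQ_le_const2)
    let ?A = "\<lambda>n. {\<omega> \<in> space M. \<exists>i\<le>n. \<bar>S (m + i) \<omega> - S m \<omega>\<bar> \<ge> \<epsilon>}"
    have "(\<lambda>n. prob (?A n)) \<longlonglongrightarrow> prob (\<Union>n. ?A n)"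
    proof (rule finite_Lim_measure_incseq)
      show "range ?A \<subseteq> events" by auto
      show "incseq ?A" by (auto simp: incseq_def intro: order_trans)
    qed
    moreover have "(\<Union>n. ?A n) = E \<epsilon> m" by (auto simp: E_def)
    ultimately show "(\<lambda>n. prob (?A n)) \<longlonglongrightarrow> prob (E \<epsilon> m)" by simp
    have "prob (?A n) \<le> R m / \<epsilon>\<^sup>2" for n
    proof -
      have "(\<Sum>i<n. (c (m + i))\<^sup>2) \<le> R m"
        unfolding R_def add.commute[of m] using summ
        by (intro sum_le_suminf) (auto simp: summable_iff_shift[of "\<lambda>k. (c k)\<^sup>2"])
      then show ?thesis
        by (intro order_trans[OF maximal_inequality[OF \<epsilon>]] divide_right_mono) auto
    qed
    then show "\<exists>N. \<forall>n\<ge>N. prob (?A n) \<le> R m / \<epsilon>\<^sup>2" by blast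
  qed
  have null: "AE \<omega> in M. \<exists>m. \<omega> \<notin> E \<epsilon> m" if \<epsilon>: "\<epsilon> > 0" for \<epsilon>
  proof -
    have "prob (\<Inter>m. E \<epsilon> m) \<le> 0"
    proof (rule LIMSEQ_le_const)
      show "(\<lambda>m. R m / \<epsilon>\<^sup>2) \<longlonglongrightarrow> 0" using tendsto_divide[OF R tendsto_const[of "\<epsilon>\<^sup>2"]] \<epsilon> by simp
      have "prob (\<Inter>m. E \<epsilon> m) \<le> R m / \<epsilon>\<^sup>2" for m
        by (rule order_trans[OF finite_measure_mono PE[OF \<epsilon>]]) auto
      then show "\<exists>N. \<forall>m\<ge>N. prob (\<Inter>m. E \<epsilon> m) \<le> R m / \<epsilon>\<^sup>2" by blast
    qed
    then have "prob (\<Inter>m. E \<epsilon> m) = 0" by (simp add: measure_le_0_iff)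
    then have "AE \<omega> in M. \<omega> \<notin> (\<Inter>m. E \<epsilon> m)"
      by (subst (asm) prob_eq_0) auto
    then show ?thesis by simp
  qed
  have "AE \<omega> in M. \<forall>l::nat. \<exists>m. \<omega> \<notin> E (1 / real (Suc l)) m"
    by (subst AE_all_countable) (auto intro!: null)
  then show ?thesis
  proof (rule AE_mp, intro AE_I2 impI)
    fix \<omega> assume \<omega>: "\<omega> \<in> space M" and A: "\<forall>l. \<exists>m. \<omega> \<notin> E (1 / real (Suc l)) m"
    have "Cauchy (\<lambda>k. S k \<omega>)"
    proof (rule metric_CauchyI)
      fix \<epsilon> :: real assume "\<epsilon> > 0"
      then obtain l where l: "1 / real (Suc l) < \<epsilon> / 2"
        using nat_approx_posE[of "\<epsilon> / 2"] by auto
      obtain m where m: "\<omega> \<notin> E (1 / real (Suc l)) m" using A by blast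
      have close: "\<bar>S k \<omega> - S m \<omega>\<bar> < \<epsilon> / 2" if "k \<ge> m" for k
      proof -
        have "\<bar>S (m + (k - m)) \<omega> - S m \<omega>\<bar> < 1 / real (Suc l)"
          using m \<omega> unfolding E_def by (auto simp: not_le)
        then show ?thesis using that l by simp
      qed
      show "\<exists>m. \<forall>i\<ge>m. \<forall>j\<ge>m. dist (S i \<omega>) (S j \<omega>) < \<epsilon>"
      proof (intro exI[of _ m] allI impI)
        fix i j assume "m \<le> i" "m \<le> j"
        then show "dist (S i \<omega>) (S j \<omega>) < \<epsilon>"
          using close[of i] close[of j] unfolding dist_real_def by linarith
      qed
    qed
    then show "convergent (\<lambda>k. S k \<omega>)" by (rule Cauchy_convergent)
  qed
qed

end

section \<open>Weak convergence of the derivatives\<close>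

text \<open>
  The measure \<open>normalized_deriv F\<close> before it is wrapped around the circle.  On the real line, the
  theory of distribution functions and Helly's theorem apply to it.
\<close>

definition lift_distribution :: "(real \<Rightarrow> real) \<Rightarrow> real measure" where
  "lift_distribution F = uniform_measure (interval_measure F) {0<..2 * pi}"

lemma cis_measurable_circle [measurable]: "cis \<in> borel \<rightarrow>\<^sub>M circle_borel"
  unfolding circle_borel_def
  by (intro measurable_restrict_space2 borel_measurable_continuous_onI continuous_intros) auto

lemma borel_measurable_circle_continuous:
  fixes f :: "complex \<Rightarrow> real"
  assumes "continuous_on (sphere 0 1) f"
  shows "f \<in> borel_measurable circle_borel"
  unfolding circle_borel_def by (rule borel_measurable_continuous_on_restrict[OF assms])

lemma emeasure_lift_Ioc:
  assumes "circle_lift F" "a \<le> b"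
  shows "emeasure (interval_measure F) {a<..b} = ennreal (F b - F a)"
  using assms by (intro emeasure_interval_measure_Ioc) (auto simp: circle_lift_def dest: monoD)

lemma emeasure_lift_period:
  assumes "circle_lift F"
  shows "emeasure (interval_measure F) {0<..2 * pi} = ennreal (2 * pi)"
proof -
  have "F (2 * pi) = F 0 + 2 * pi" using assms unfolding circle_lift_def by (metis add_0)
  then show ?thesis using emeasure_lift_Ioc[OF assms, of 0 "2 * pi"] by simp
qed

lemma real_distribution_lift:
  assumes "circle_lift F" shows "real_distribution (lift_distribution F)"
proof -
  interpret prob_space "lift_distribution F"
    unfolding lift_distribution_def
    by (rule prob_space_uniform_measure) (simp_all add: emeasure_lift_period[OF assms])
  show ?thesis by standard (simp add: lift_distribution_def)
qed

lemma measure_lift_distribution_Ioc: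
  assumes F: "circle_lift F" and ab: "0 \<le> a" "a \<le> b" "b \<le> 2 * pi"
  shows "measure (lift_distribution F) {a<..b} = (F b - F a) / (2 * pi)"
proof -
  have "{0<..2 * pi} \<inter> {a<..b} = {a<..b}" using ab by auto
  moreover have "F a \<le> F b" using F ab by (auto simp: circle_lift_def dest: monoD)
  ultimately show ?thesis
    unfolding lift_distribution_def
    by (subst measure_uniform_measure)
      (auto simp: emeasure_lift_period[OF F] emeasure_lift_Ioc[OF F] measure_def ab)
qed

lemma AE_lift_distribution:
  assumes F: "circle_lift F"
  shows "AE x in lift_distribution F. x \<in> {0<..2 * pi}"
  unfolding lift_distribution_def by (rule AE_uniform_measureI) auto

lemma normalized_deriv_eq_distr:
  assumes F: "circle_lift F"
  shows "normalized_deriv F = distr (lift_distribution F) circle_borel cis"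
proof (rule measure_eqI)
  show "sets (normalized_deriv F) = sets (distr (lift_distribution F) circle_borel cis)"
    by (simp add: normalized_deriv_def)
next
  fix A assume "A \<in> sets (normalized_deriv F)"
  then have A[measurable]: "A \<in> sets circle_borel" by (simp add: normalized_deriv_def)
  have c: "cis -` A \<in> sets borel"
    using measurable_sets[OF cis_measurable_circle A] by simp
  let ?I = "{0<..2 * pi} :: real set"
  have "cis \<in> restrict_space (interval_measure F) ?I \<rightarrow>\<^sub>M circle_borel"
    by (intro measurable_restrict_space1) simp
  then have "emeasure (normalized_deriv F) A =
      ennreal (1 / (2 * pi)) * emeasure (interval_measure F) (?I \<inter> cis -` A)"
    unfolding normalized_deriv_def
    by (simp add: emeasure_distr space_restrict_space emeasure_restrict_space Int_commute)
  also have "\<dots> = emeasure (interval_measure F) (?I \<inter> cis -` A) / ennreal (2 * pi)"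
    by (simp add: divide_ennreal_def inverse_ennreal mult.commute inverse_eq_divide)
  also have "\<dots> = emeasure (distr (lift_distribution F) circle_borel cis) A"
    using c by (simp add: emeasure_distr lift_distribution_def emeasure_lift_period[OF F])
  finally show "emeasure (normalized_deriv F) A = emeasure (distr (lift_distribution F) circle_borel cis) A" .
qed

lemma distr_cis_in_prob_algebra:
  assumes "real_distribution R"
  shows "distr R circle_borel cis \<in> space (prob_algebra circle_borel)"
proof -
  interpret real_distribution R by fact
  show ?thesis by (simp add: space_prob_algebra prob_space_distr)
qed

lemma integral_distr_cis:
  fixes f :: "complex \<Rightarrow> real"
  assumes "real_distribution R" and f: "continuous_on (sphere 0 1) f"
  shows "(\<integral>z. f z \<partial>distr R circle_borel cis) = (\<integral>x. f (cis x) \<partial>R)"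
proof -
  interpret real_distribution R by fact
  show ?thesis by (rule integral_distr) (use borel_measurable_circle_continuous[OF f] in auto)
qed

text \<open>
  The indicator of a closed set is a decreasing limit of continuous functions of the distance to
  it, so the integrals of continuous functions determine the measures of closed sets, an
  intersection-stable generator of the Borel sets.
\<close>

lemma circle_measure_eqI:
  assumes \<mu>: "\<mu> \<in> space (prob_algebra circle_borel)" and \<nu>: "\<nu> \<in> space (prob_algebra circle_borel)"
    and eq: "\<And>f :: complex \<Rightarrow> real. continuous_on (sphere 0 1) f \<Longrightarrow> (\<integral>z. f z \<partial>\<mu>) = (\<integral>z. f z \<partial>\<nu>)"
  shows "\<mu> = \<nu>"
proof -
  have sets: "sets \<mu> = sets circle_borel" "sets \<nu> = sets circle_borel"
    and "prob_space \<mu>" "prob_space \<nu>"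
    using \<mu> \<nu> by (auto simp: space_prob_algebra)
  interpret \<mu>: prob_space \<mu> by fact
  interpret \<nu>: prob_space \<nu> by fact
  have space: "space \<mu> = sphere 0 1" "space \<nu> = sphere 0 1"
    using sets[THEN sets_eq_imp_space_eq] by (simp_all add: circle_borel_def space_restrict_space)
  have meas: "borel_measurable \<mu> = borel_measurable circle_borel"
    "borel_measurable \<nu> = borel_measurable circle_borel"
    by (auto intro!: measurable_cong_sets sets)
  have m\<mu>: "(\<lambda>z. z) \<in> borel_measurable \<mu>" and m\<nu>: "(\<lambda>z. z) \<in> borel_measurable \<nu>"
    unfolding meas circle_borel_def by (auto intro: measurable_restrict_space1)
  have closed_eq: "emeasure \<mu> (C \<inter> sphere 0 1) = emeasure \<nu> (C \<inter> sphere 0 1)"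
    if C: "closed C" "C \<noteq> {}" for C :: "complex set"
  proof -
    define g where "g k z = max 0 (1 - real k * infdist z C)" for k z
    have g_cont: "continuous_on X (g k)" for X k
      unfolding g_def by (intro continuous_intros)
    have g_bd: "norm (g k z) \<le> 1" for k z
      by (simp add: g_def infdist_nonneg)
    have g_lim: "(\<lambda>k. g k z) \<longlonglongrightarrow> indicator C z" for z
    proof (cases "z \<in> C")
      case True
      then show ?thesis by (simp add: g_def)
    next
      case False
      then have d: "infdist z C > 0"
        using C by (simp add: infdist_pos_not_in_closed)
      obtain k0 where k0: "1 < real k0 * infdist z C"
        using reals_Archimedean3[OF d] by blast
      have "g k z = 0" if "k \<ge> k0" for k
      proof -
        have "real k0 * infdist z C \<le> real k * infdist z C"
          using that d by (intro mult_right_mono) auto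
        then show ?thesis using k0 by (simp add: g_def)
      qed
      then have "\<forall>\<^sub>F k in sequentially. 0 = g k z"
        by (auto simp: eventually_sequentially intro!: exI[of _ k0])
      then show ?thesis using False
        by (auto intro: Lim_transform_eventually[OF tendsto_const])
    qed
    have lim: "(\<lambda>k. \<integral>z. g k z \<partial>R) \<longlonglongrightarrow> measure R (C \<inter> sphere 0 1)"
      if "finite_measure R" "sets R = sets circle_borel" for R
    proof -
      interpret R: finite_measure R by fact
      have sp: "space R = sphere 0 1"
        using that(2)[THEN sets_eq_imp_space_eq] by (simp add: circle_borel_def space_restrict_space)
      have mR: "borel_measurable R = borel_measurable circle_borel"
        by (intro measurable_cong_sets that refl)
      have mi: "(\<lambda>z. indicator C z :: real) \<in> borel_measurable R"
        unfolding mR circle_borel_def using C by (auto intro!: measurable_restrict_space1)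
      have mg: "g k \<in> borel_measurable R" for k
        unfolding mR by (intro borel_measurable_circle_continuous g_cont)
      have "(\<lambda>k. \<integral>z. g k z \<partial>R) \<longlonglongrightarrow> (\<integral>z. indicator C z \<partial>R)"
        by (rule integral_dominated_convergence[where w="\<lambda>_. 1", OF mi mg]) (auto simp: g_lim g_bd[unfolded real_norm_def])
      then show ?thesis by (simp add: sp)
    qed
    have "(\<lambda>k. \<integral>z. g k z \<partial>\<mu>) = (\<lambda>k. \<integral>z. g k z \<partial>\<nu>)" by (intro ext eq g_cont)
    then have "measure \<mu> (C \<inter> sphere 0 1) = measure \<nu> (C \<inter> sphere 0 1)"
      using lim[OF \<mu>.finite_measure_axioms sets(1)] lim[OF \<nu>.finite_measure_axioms sets(2)]
      by (auto intro: LIMSEQ_unique)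
    then show ?thesis by (simp add: \<mu>.emeasure_eq_measure \<nu>.emeasure_eq_measure)
  qed
  \<comment> \<open>Viewing both measures on the whole plane makes the closed sets a generator.\<close>
  have "distr \<mu> borel (\<lambda>z. z) = distr \<nu> borel (\<lambda>z. z)"
  proof (rule measure_eqI_generator_eq[where E="{C :: complex set. closed C}" and \<Omega>=UNIV and A="\<lambda>_. UNIV"])
    show "Int_stable {C :: complex set. closed C}" by (auto simp: Int_stable_def)
    fix C :: "complex set" assume "C \<in> {C. closed C}"
    then show "emeasure (distr \<mu> borel (\<lambda>z. z)) C = emeasure (distr \<nu> borel (\<lambda>z. z)) C"
      using closed_eq[of C] m\<mu> m\<nu> by (cases "C = {}") (auto simp: emeasure_distr space)
  next
    show "sets (distr \<mu> borel (\<lambda>z. z)) = sigma_sets UNIV {C :: complex set. closed C}"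
      "sets (distr \<nu> borel (\<lambda>z. z)) = sigma_sets UNIV {C :: complex set. closed C}"
      by (simp_all add: borel_eq_closed)
    show "emeasure (distr \<mu> borel (\<lambda>z. z)) UNIV \<noteq> \<infinity>"
      using m\<mu> by (simp add: emeasure_distr)
  qed auto
  note distr_eq = this
  show ?thesis
  proof (rule measure_eqI)
    fix A assume "A \<in> sets \<mu>"
    then have A: "A \<in> sets borel" "A \<subseteq> sphere 0 1"
      using sets by (auto simp: circle_borel_def sets_restrict_space)
    then show "emeasure \<mu> A = emeasure \<nu> A"
      using arg_cong[OF distr_eq, of "\<lambda>R. emeasure R A"] m\<mu> m\<nu>
      by (simp add: emeasure_distr space Int_absorb2)
  qed (simp add: sets)
qed

lemma convergent_if_uniform_approx:
  fixes a :: "nat \<Rightarrow> real"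
  assumes "\<And>\<epsilon>. \<epsilon> > 0 \<Longrightarrow> \<exists>b. convergent b \<and> (\<forall>N. \<bar>a N - b N\<bar> \<le> \<epsilon>)"
  shows "convergent a"
proof (rule Cauchy_convergent, rule metric_CauchyI)
  fix \<epsilon> :: real assume "\<epsilon> > 0"
  then obtain b where b: "convergent b" "\<And>N. \<bar>a N - b N\<bar> \<le> \<epsilon> / 4"
    using assms[of "\<epsilon> / 4"] by auto
  from b(1) have "Cauchy b" by (rule convergent_Cauchy)
  then have "\<exists>M. \<forall>m\<ge>M. \<forall>n\<ge>M. dist (b m) (b n) < \<epsilon> / 4"
    using \<open>\<epsilon> > 0\<close> by (intro metric_CauchyD) auto
  then obtain M where M: "\<And>m n. m \<ge> M \<Longrightarrow> n \<ge> M \<Longrightarrow> dist (b m) (b n) < \<epsilon> / 4"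
    by blast
  show "\<exists>M. \<forall>m\<ge>M. \<forall>n\<ge>M. dist (a m) (a n) < \<epsilon>"
  proof (intro exI[of _ M] allI impI)
    fix m n assume "M \<le> m" "M \<le> n"
    then show "dist (a m) (a n) < \<epsilon>"
      using M[of m n] b(2)[of m] b(2)[of n] \<open>\<epsilon> > 0\<close> unfolding dist_real_def by linarith
  qed
qed

text \<open>
  A step function on a partition of mesh \<open>2\<pi>/m\<close> is uniformly close to \<open>g\<close>, hence its integrals are
  close to those of \<open>g\<close> for all \<open>N\<close> at once.  Its integrals are Riemann-Stieltjes sums that depend
  on \<open>F N\<close> only at the partition points.
\<close>

lemma convergent_lift_integral:
  fixes F :: "nat \<Rightarrow> real \<Rightarrow> real" and g :: "real \<Rightarrow> real"
  assumes F: "\<And>N. circle_lift (F N)"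
    and conv: "\<And>m j. m \<ge> 1 \<Longrightarrow> j \<le> m \<Longrightarrow> convergent (\<lambda>N. F N (2 * pi * real j / real m))"
    and g: "continuous_on UNIV g" and bd: "\<And>x. \<bar>g x\<bar> \<le> B"
  shows "convergent (\<lambda>N. \<integral>x. g x \<partial>lift_distribution (F N))"
proof (rule convergent_if_uniform_approx)
  fix \<epsilon> :: real assume \<epsilon>: "\<epsilon> > 0"
  have g_borel: "g \<in> borel_measurable borel" by (rule borel_measurable_continuous_onI[OF g])
  have "uniformly_continuous_on {0..2 * pi} g"
    by (rule compact_uniformly_continuous) (auto intro: continuous_on_subset[OF g])
  then obtain \<delta> where \<delta>: "\<delta> > 0"
    "\<And>x y. x \<in> {0..2 * pi} \<Longrightarrow> y \<in> {0..2 * pi} \<Longrightarrow> dist y x < \<delta> \<Longrightarrow> dist (g y) (g x) < \<epsilon>"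
    unfolding uniformly_continuous_on_def using \<epsilon> by metis
  obtain m where m: "2 * pi / \<delta> < real m" "m \<ge> 1"
    using reals_Archimedean2[of "max 1 (2 * pi / \<delta>)"] by auto
  then have mesh: "2 * pi / real m < \<delta>" using \<delta>(1) by (simp add: field_simps)
  define d where "d j = 2 * pi * real j / real m" for j
  have d0: "d 0 = 0" and dm: "d m = 2 * pi" using m by (simp_all add: d_def)
  have dS: "d (Suc j) = d j + 2 * pi / real m" for j by (simp add: d_def add_divide_distrib distrib_left)
  have dmono: "d i \<le> d j" if "i \<le> j" for i j
    using that m by (auto simp: d_def intro!: divide_right_mono)
  define s where "s x = (\<Sum>j<m. g (d (Suc j)) * indicator {d j<..d (Suc j)} x)" for x
  have s_close: "\<bar>g x - s x\<bar> \<le> \<epsilon>" if x: "x \<in> {0<..2 * pi}" for x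
  proof -
    \<comment> \<open>The partition interval that contains \<open>x\<close> is the one that ends at \<open>d j\<close>.\<close>
    define j where "j = (LEAST i. x \<le> d i)"
    have ex: "x \<le> d m" using x dm by simp
    have xj: "x \<le> d j" unfolding j_def by (rule LeastI) (rule ex)
    have jm: "j \<le> m" unfolding j_def by (rule Least_le) (rule ex)
    have "j \<noteq> 0" using xj x d0 by (cases j) auto
    then obtain i where i: "j = Suc i" by (cases j) auto
    have xi: "d i < x" using not_less_Least[of i "\<lambda>i. x \<le> d i"] i by (simp add: j_def[symmetric])
    have "indicator {d k<..d (Suc k)} x = (if k = i then 1 else 0 :: real)" for k
    proof (cases "k = i")
      case True
      then show ?thesis using xi xj i by simp
    next
      case False
      then consider "Suc k \<le> i" | "Suc i \<le> k" by linarith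
      then have "x \<notin> {d k<..d (Suc k)}"
        using dmono xi xj i by cases (fastforce dest: dmono)+
      then show ?thesis using False by simp
    qed
    then have "s x = (\<Sum>k<m. g (d (Suc k)) * (if k = i then 1 else 0))"
      unfolding s_def by (simp only:)
    also have "\<dots> = (\<Sum>k<m. if k = i then g (d (Suc k)) else 0)"
      by (rule sum.cong) auto
    also have "\<dots> = g (d (Suc i))" using jm i by simp
    finally have "s x = g (d (Suc i))" .
    moreover have "dist (g x) (g (d (Suc i))) < \<epsilon>"
    proof (rule \<delta>(2))
      show "d (Suc i) \<in> {0..2 * pi}" using dmono[of 0 "Suc i"] dmono[of "Suc i" m] jm i d0 dm by auto
      show "dist x (d (Suc i)) < \<delta>" using xi xj i dS[of i] mesh by (simp add: dist_real_def)
    qed (use x in auto)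
    ultimately show ?thesis by (simp add: dist_real_def)
  qed
  have s_int: "(\<integral>x. s x \<partial>lift_distribution (F N)) =
      (\<Sum>j<m. g (d (Suc j)) * ((F N (d (Suc j)) - F N (d j)) / (2 * pi)))" for N
  proof -
    interpret real_distribution "lift_distribution (F N)" by (rule real_distribution_lift[OF F])
    have "(\<integral>x. s x \<partial>lift_distribution (F N)) =
        (\<Sum>j<m. g (d (Suc j)) * prob {d j<..d (Suc j)})"
      unfolding s_def
      by (subst Bochner_Integration.integral_sum) (auto simp: integrable_real_mult_indicator emeasure_eq_measure)
    also have "\<dots> = (\<Sum>j<m. g (d (Suc j)) * ((F N (d (Suc j)) - F N (d j)) / (2 * pi)))"
    proof (intro sum.cong refl arg_cong2[where f="(*)"])
      fix j assume "j \<in> {..<m}"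
      then show "prob {d j<..d (Suc j)} = (F N (d (Suc j)) - F N (d j)) / (2 * pi)"
        using dmono[of 0 j] dmono[of j "Suc j"] dmono[of "Suc j" m]
        by (intro measure_lift_distribution_Ioc F) (auto simp: d0 dm)
    qed
    finally show ?thesis .
  qed
  have "convergent (\<lambda>N. \<integral>x. s x \<partial>lift_distribution (F N))"
    unfolding s_int
  proof (intro convergent_sum)
    fix j assume "j \<in> {..<m}"
    then have "convergent (\<lambda>N. F N (d (Suc j)))" "convergent (\<lambda>N. F N (d j))"
      unfolding d_def using m by (intro conv; simp)+
    then obtain L L' where "(\<lambda>N. F N (d (Suc j))) \<longlonglongrightarrow> L" "(\<lambda>N. F N (d j)) \<longlonglongrightarrow> L'"
      by (auto simp: convergent_def)
    then have "(\<lambda>N. g (d (Suc j)) * ((F N (d (Suc j)) - F N (d j)) / (2 * pi)))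
        \<longlonglongrightarrow> g (d (Suc j)) * ((L - L') / (2 * pi))"
      by (intro tendsto_intros) auto
    then show "convergent (\<lambda>N. g (d (Suc j)) * ((F N (d (Suc j)) - F N (d j)) / (2 * pi)))"
      by (rule convergentI)
  qed
  moreover have "\<bar>(\<integral>x. g x \<partial>lift_distribution (F N)) - (\<integral>x. s x \<partial>lift_distribution (F N))\<bar> \<le> \<epsilon>" for N
  proof -
    interpret real_distribution "lift_distribution (F N)" by (rule real_distribution_lift[OF F])
    have ig: "integrable (lift_distribution (F N)) g"
      by (rule integrable_const_bound[where B=B]) (use bd g_borel in auto)
    have s_integrable: "integrable (lift_distribution (F N)) s"
      unfolding s_def by (intro Bochner_Integration.integrable_sum integrable_real_mult_indicator) auto
    have "AE x in lift_distribution (F N). \<bar>g x - s x\<bar> \<le> \<epsilon>"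
      using AE_lift_distribution[OF F] by eventually_elim (rule s_close)
    then have "(\<integral>x. \<bar>g x - s x\<bar> \<partial>lift_distribution (F N)) \<le> (\<integral>x. \<epsilon> \<partial>lift_distribution (F N))"
      using ig s_integrable by (intro integral_mono_AE) auto
    then have "\<bar>\<integral>x. g x - s x \<partial>lift_distribution (F N)\<bar> \<le> (\<integral>x. \<epsilon> \<partial>lift_distribution (F N))"
      by (rule order_trans[OF integral_abs_bound])
    then show ?thesis using ig s_integrable prob_space by simp
  qed
  ultimately show "\<exists>b. convergent b \<and> (\<forall>N. \<bar>(\<integral>x. g x \<partial>lift_distribution (F N)) - b N\<bar> \<le> \<epsilon>)"
    by (intro exI[of _ "\<lambda>N. \<integral>x. s x \<partial>lift_distribution (F N)"]) auto
qed

lemma tight_lift_distribution: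
  assumes F: "\<And>N. circle_lift (F N)"
  shows "tight (\<lambda>N. lift_distribution (F N))"
  unfolding tight_def
proof (intro conjI allI impI)
  fix \<epsilon> :: real assume "\<epsilon> > 0"
  have "F N (2 * pi) = F N 0 + 2 * pi" for N using F[of N] unfolding circle_lift_def by (metis add_0)
  then have "measure (lift_distribution (F N)) {0<..2 * pi} = 1" for N
    by (subst measure_lift_distribution_Ioc[OF F]) auto
  then show "\<exists>a b. a < b \<and> (\<forall>N. measure (lift_distribution (F N)) {a<..b} > 1 - \<epsilon>)"
    using \<open>\<epsilon> > 0\<close> by (intro exI[of _ 0] exI[of _ "2 * pi"]) auto
qed (rule real_distribution_lift[OF F])

text \<open>
  Convergence of the integrals along the full sequence forces all subsequential limits to agree;
  compactness supplies one.
\<close>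

theorem unique_weak_star_limit:
  fixes F :: "nat \<Rightarrow> real \<Rightarrow> real"
  assumes F: "\<And>N. circle_lift (F N)"
    and conv: "\<And>m j. m \<ge> 1 \<Longrightarrow> j \<le> m \<Longrightarrow> convergent (\<lambda>N. F N (2 * pi * real j / real m))"
  shows "\<exists>!\<mu>. weak_star_limit (\<lambda>N. normalized_deriv (F N)) \<mu>"
proof -
  let ?R = "\<lambda>N. lift_distribution (F N)"
  let ?\<sigma> = "\<lambda>N. normalized_deriv (F N)"
  have \<sigma>: "?\<sigma> N = distr (?R N) circle_borel cis" for N by (rule normalized_deriv_eq_distr[OF F])
  have \<sigma>_prob: "?\<sigma> N \<in> space (prob_algebra circle_borel)" for N
    unfolding \<sigma> by (rule distr_cis_in_prob_algebra[OF real_distribution_lift[OF F]])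
  have cis_comp: "continuous_on UNIV (\<lambda>x. f (cis x))" "\<exists>B. \<forall>x. \<bar>f (cis x)\<bar> \<le> B"
    if f: "continuous_on (sphere 0 1) f" for f :: "complex \<Rightarrow> real"
  proof -
    show "continuous_on UNIV (\<lambda>x. f (cis x))"
      by (rule continuous_on_compose2[OF f]) (auto intro!: continuous_intros)
    have "bounded (f ` sphere 0 1)"
      by (intro compact_imp_bounded compact_continuous_image f) auto
    then obtain B where "\<forall>y\<in>f ` sphere 0 1. norm y \<le> B" unfolding bounded_iff by blast
    then show "\<exists>B. \<forall>x. \<bar>f (cis x)\<bar> \<le> B" by (intro exI[of _ B]) auto
  qed
  have int_conv: "convergent (\<lambda>N. \<integral>z. f z \<partial>?\<sigma> N)"
    if f: "continuous_on (sphere 0 1) f" for f :: "complex \<Rightarrow> real"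
  proof -
    obtain B where "\<And>x. \<bar>f (cis x)\<bar> \<le> B" using cis_comp(2)[OF f] by blast
    then have "convergent (\<lambda>N. \<integral>x. f (cis x) \<partial>?R N)"
      by (intro convergent_lift_integral[where g="\<lambda>x. f (cis x)" and B=B] F conv cis_comp(1)[OF f])
    then show ?thesis
      unfolding \<sigma> by (simp add: integral_distr_cis[OF real_distribution_lift[OF F] f])
  qed
  have limit_iff: "weak_star_limit ?\<sigma> \<mu> \<longleftrightarrow> (\<exists>k. strict_mono k \<and> \<mu> \<in> space (prob_algebra circle_borel) \<and>
      (\<forall>f :: complex \<Rightarrow> real. continuous_on (sphere 0 1) f \<longrightarrow>
         (\<lambda>j. \<integral>z. f z \<partial>?\<sigma> (k j)) \<longlonglongrightarrow> (\<integral>z. f z \<partial>\<mu>)))" for \<mu>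
    unfolding weak_star_limit_def by (subst limitin_weak_star_topology_iff[OF \<sigma>_prob]) blast
  have full_limit: "(\<integral>z. f z \<partial>\<mu>) = lim (\<lambda>N. \<integral>z. f z \<partial>?\<sigma> N)"
    if \<mu>: "weak_star_limit ?\<sigma> \<mu>" and f: "continuous_on (sphere 0 1) f" for \<mu> and f :: "complex \<Rightarrow> real"
  proof -
    obtain k where k: "strict_mono k" "(\<lambda>j. \<integral>z. f z \<partial>?\<sigma> (k j)) \<longlonglongrightarrow> (\<integral>z. f z \<partial>\<mu>)"
      using \<mu> f unfolding limit_iff by blast
    have "(\<lambda>N. \<integral>z. f z \<partial>?\<sigma> N) \<longlonglongrightarrow> lim (\<lambda>N. \<integral>z. f z \<partial>?\<sigma> N)"
      using int_conv[OF f] by (simp add: convergent_LIMSEQ_iff)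
    from LIMSEQ_subseq_LIMSEQ[OF this k(1)] k(2) show ?thesis
      by (auto simp: o_def intro: LIMSEQ_unique)
  qed
  have "strict_mono (id :: nat \<Rightarrow> nat)" by (simp add: strict_mono_def)
  from tight_imp_convergent_subsubsequence[OF tight_lift_distribution[OF F] this]
  have "\<exists>k R. strict_mono k \<and> real_distribution R \<and> weak_conv_m (?R \<circ> k) R"
    by (simp only: comp_id)
  then obtain k R where k: "strict_mono k" and R: "real_distribution R" and weak: "weak_conv_m (?R \<circ> k) R"
    by (elim exE conjE) (rule that)
  have "weak_star_limit ?\<sigma> (distr R circle_borel cis)"
    unfolding limit_iff
  proof (intro exI[of _ k] conjI allI impI k distr_cis_in_prob_algebra R)
    fix f :: "complex \<Rightarrow> real" assume f: "continuous_on (sphere 0 1) f"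
    obtain B where B: "\<And>x. \<bar>f (cis x)\<bar> \<le> B" using cis_comp(2)[OF f] by blast
    have "(\<lambda>j. \<integral>x. f (cis x) \<partial>(?R \<circ> k) j) \<longlonglongrightarrow> (\<integral>x. f (cis x) \<partial>R)"
    proof (rule weak_conv_imp_integral_bdd_continuous_conv[OF _ R weak])
      show "real_distribution ((?R \<circ> k) j)" for j by (simp add: real_distribution_lift[OF F])
      show "isCont (\<lambda>x. f (cis x)) x" for x
        using cis_comp(1)[OF f] by (simp add: continuous_on_eq_continuous_at)
      show "norm (f (cis x)) \<le> B" for x using B by simp
    qed
    then show "(\<lambda>j. \<integral>z. f z \<partial>?\<sigma> (k j)) \<longlonglongrightarrow> (\<integral>z. f z \<partial>distr R circle_borel cis)"
      unfolding \<sigma> by (simp add: integral_distr_cis[OF real_distribution_lift[OF F] f] integral_distr_cis[OF R f])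
  qed
  moreover have "\<mu> = \<nu>" if "weak_star_limit ?\<sigma> \<mu>" "weak_star_limit ?\<sigma> \<nu>" for \<mu> \<nu>
  proof (rule circle_measure_eqI)
    show "\<mu> \<in> space (prob_algebra circle_borel)" "\<nu> \<in> space (prob_algebra circle_borel)"
      using that unfolding limit_iff by blast+
  qed (use that full_limit in auto)
  ultimately show ?thesis by blast
qed

section \<open>Almost sure convergence of the compositions\<close>

lemma subalgebra_vimage_algebra:
  "Y \<in> measurable M N \<Longrightarrow> subalgebra M (vimage_algebra (space M) Y N)"
  unfolding subalgebra_def by (simp add: sets_image_in_sets)

context prob_space
begin

definition gen_algebra :: "('i \<Rightarrow> 'a \<Rightarrow> real) \<Rightarrow> 'i set \<Rightarrow> 'a measure" where
  "gen_algebra q A = vimage_algebra (space M) (\<lambda>\<omega>. \<lambda>i\<in>A. q i \<omega>) (\<Pi>\<^sub>M i\<in>A. borel)"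

lemma measurable_gen_algebra: "i \<in> A \<Longrightarrow> q i \<in> borel_measurable (gen_algebra q A)"
proof -
  assume i: "i \<in> A"
  have "(\<lambda>\<omega>. \<lambda>i\<in>A. q i \<omega>) \<in> gen_algebra q A \<rightarrow>\<^sub>M (\<Pi>\<^sub>M i\<in>A. borel)"
    unfolding gen_algebra_def by (rule measurable_vimage_algebra1) (auto simp: space_PiM)
  from measurable_compose[OF this measurable_component_singleton[OF i]] show ?thesis
    using i by simp
qed

lemma space_gen_algebra [simp]: "space (gen_algebra q A) = space M"
  by (simp add: gen_algebra_def)

lemma subalgebra_gen_algebra_mono:
  assumes "A \<subseteq> B" shows "subalgebra (gen_algebra q B) (gen_algebra q A)"
proof -
  have "(\<lambda>\<omega>. \<lambda>i\<in>A. q i \<omega>) \<in> gen_algebra q B \<rightarrow>\<^sub>M (\<Pi>\<^sub>M i\<in>A. borel)"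
    using assms by (intro measurable_restrict measurable_gen_algebra) auto
  from subalgebra_vimage_algebra[OF this] show ?thesis by (simp add: gen_algebra_def)
qed

lemma subalgebra_gen_algebra:
  assumes "\<And>i. i \<in> A \<Longrightarrow> random_variable borel (q i)" shows "subalgebra M (gen_algebra q A)"
  unfolding gen_algebra_def using assms by (intro subalgebra_vimage_algebra measurable_restrict) auto

text \<open>
  The grouping lemma for families of independent variables yields independence of two restricted
  tuples; the second tuple has the single entry \<open>q n\<close>.
\<close>

lemma indep_set_gen_algebra:
  fixes q :: "'i \<Rightarrow> 'a \<Rightarrow> real"
  assumes ind: "indep_vars (\<lambda>_. borel) q I" and A: "A \<subseteq> I" and n: "n \<in> I" "n \<notin> A"
  shows "indep_set (sets (gen_algebra q A)) {q n -` B \<inter> space M | B. B \<in> sets borel}"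
proof -
  let ?YA = "\<lambda>\<omega>. \<lambda>i\<in>A. q i \<omega>" and ?Yn = "\<lambda>\<omega>. \<lambda>i\<in>{n}. q i \<omega>"
  have "indep_var (\<Pi>\<^sub>M i\<in>A. borel) ?YA (\<Pi>\<^sub>M i\<in>{n}. borel) ?Yn"
    by (rule indep_var_restrict[OF ind]) (use A n in auto)
  then have *: "indep_set
      (sigma_sets (space M) {?YA -` X \<inter> space M | X. X \<in> sets (\<Pi>\<^sub>M i\<in>A. borel)})
      (sigma_sets (space M) {?Yn -` X \<inter> space M | X. X \<in> sets (\<Pi>\<^sub>M i\<in>{n}. borel)})"
    unfolding indep_var_eq by blast
  have sA: "sets (gen_algebra q A) = sigma_sets (space M) {?YA -` X \<inter> space M | X. X \<in> sets (\<Pi>\<^sub>M i\<in>A. borel)}"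
    unfolding gen_algebra_def by (rule sets_vimage_algebra)
  have sn: "{q n -` B \<inter> space M | B. B \<in> sets borel} \<subseteq>
      sigma_sets (space M) {?Yn -` X \<inter> space M | X. X \<in> sets (\<Pi>\<^sub>M i\<in>{n}. borel)}"
  proof clarify
    fix B :: "real set" assume B: "B \<in> sets borel"
    let ?X = "(\<lambda>x. x n) -` B \<inter> space (\<Pi>\<^sub>M i\<in>{n}. borel :: real measure)"
    have "?X \<in> sets (\<Pi>\<^sub>M i\<in>{n}. borel)"
      by (rule measurable_sets[OF _ B]) (rule measurable_component_singleton, simp)
    moreover have "q n -` B \<inter> space M = ?Yn -` ?X \<inter> space M"
      by (auto simp: space_PiM)
    ultimately show "q n -` B \<inter> space M \<in>
        sigma_sets (space M) {?Yn -` X \<inter> space M | X. X \<in> sets (\<Pi>\<^sub>M i\<in>{n}. borel)}"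
      by blast
  qed
  show ?thesis
  proof (rule indep_setI)
    show "sets (gen_algebra q A) \<subseteq> events" unfolding sA by (rule indep_setD_ev1[OF *])
    show "{q n -` B \<inter> space M | B. B \<in> sets borel} \<subseteq> events"
      using sn indep_setD_ev2[OF *] by (rule order_trans)
    show "prob (a \<inter> b) = prob a * prob b"
      if "a \<in> sets (gen_algebra q A)" "b \<in> {q n -` B \<inter> space M | B. B \<in> sets borel}" for a b
      by (rule indep_setD[OF *]) (use that sA sn in blast)+
  qed
qed

text \<open>
  Time \<open>k\<close> corresponds to the information in the phases with indices \<open>p 1, ..., p k\<close>.  Injectivity
  of \<open>p\<close> makes the phase with index \<open>p (k + 1)\<close> new, hence independent of it, and also bounds the
  sum of the squared increment bounds by that of the whole series \<open>\<Sum> (\<pi>/n)\<^sup>2\<close>.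
\<close>

lemma AE_convergent_Sigma_comp:
  fixes p :: "nat \<Rightarrow> nat" and r :: "nat \<Rightarrow> real" and q :: "nat \<Rightarrow> 'a \<Rightarrow> real"
  assumes p: "inj_on p {1..}" "p ` {1..} \<subseteq> {1..}"
    and r: "\<And>n. n \<ge> 1 \<Longrightarrow> r n \<in> {0..1}"
    and ind: "indep_vars (\<lambda>_. borel) q {1..}"
    and unif: "\<And>n. n \<ge> 1 \<Longrightarrow> distr M borel (q n) = uniform_measure lborel {0..<2 * pi}"
  shows "AE \<omega> in M. convergent (\<lambda>N. Sigma_comp p (\<lambda>n. rcis (r n) (q n \<omega>)) N \<theta>)"
proof -
  define S where "S N \<omega> = Sigma_comp p (\<lambda>n. rcis (r n) (q n \<omega>)) N \<theta>" for N \<omega>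
  define F where "F k = gen_algebra q (p ` {1..k})" for k
  define c where "c k = pi / real (p (Suc k))" for k
  have p_pos: "p k \<ge> 1" if "k \<ge> 1" for k using p(2) that by (auto simp: image_subset_iff)
  then have p1: "p (Suc k) \<ge> 1" for k by simp
  have q[measurable]: "q n \<in> borel_measurable M" if "n \<ge> 1" for n
    using ind that by (auto simp: indep_vars_def)
  have S_Suc: "S (Suc k) \<omega> =
      (mobius_lift (r (p (Suc k))) (real (p (Suc k)) * S k \<omega> + q (p (Suc k)) \<omega>) - q (p (Suc k)) \<omega>)
        / real (p (Suc k))" for k \<omega>
    unfolding S_def by (simp add: Phi_eq_mobius_lift[OF r[OF p1] p1])
  have incr: "S (Suc k) \<omega> - S k \<omega> =
      (mobius_lift (r (p (Suc k))) (real (p (Suc k)) * S k \<omega> + q (p (Suc k)) \<omega>) -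
        (real (p (Suc k)) * S k \<omega> + q (p (Suc k)) \<omega>)) / real (p (Suc k))" for k \<omega>
    unfolding S_Suc using p1[of k] by (simp add: field_simps)
  have sub: "subalgebra M (F k)" for k
    unfolding F_def by (rule subalgebra_gen_algebra, rule q) (use p_pos in auto)
  have filt: "subalgebra (F (Suc k)) (F k)" for k
    unfolding F_def by (rule subalgebra_gen_algebra_mono) auto
  have adapted: "S k \<in> borel_measurable (F k)" for k
  proof (induction k)
    case 0
    then show ?case by (simp add: S_def)
  next
    case (Suc k)
    have [measurable]: "mobius_lift (r (p (Suc k))) \<in> borel_measurable borel"
      by (rule borel_measurable_mobius_lift[OF r[OF p1]])
    have [measurable]: "q (p (Suc k)) \<in> borel_measurable (F (Suc k))"
      unfolding F_def by (rule measurable_gen_algebra) simp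
    have [measurable]: "S k \<in> borel_measurable (F (Suc k))"
      by (rule measurable_from_subalg[OF filt Suc])
    show ?case unfolding S_Suc[abs_def] by measurable
  qed
  have bd: "\<bar>S (Suc k) \<omega> - S k \<omega>\<bar> \<le> c k" for k \<omega>
    unfolding incr c_def using mobius_lift_displacement_le
    by (simp add: divide_right_mono)
  interpret bounded_increment_martingale M F S c
  proof unfold_locales
    fix k and Z :: "'a \<Rightarrow> real" and B :: real
    assume Z: "Z \<in> borel_measurable (F k)" and B: "\<And>\<omega>. \<bar>Z \<omega>\<bar> \<le> B"
    define n where "n = p (Suc k)"
    have n: "n \<ge> 1" unfolding n_def by (rule p1)
    note [measurable] = borel_measurable_mobius_lift[OF r[OF n]]
    \<comment> \<open>The increment tested against \<open>Z\<close>, as a function of the past pair \<open>(Z, S k)\<close> and the new phase.\<close>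
    define G where "G = (\<lambda>x :: (real \<times> real) \<times> real. fst (fst x) *
      ((mobius_lift (r n) (real n * snd (fst x) + snd x) - (real n * snd (fst x) + snd x)) / real n))"
    have G: "G \<in> borel_measurable ((borel \<Otimes>\<^sub>M borel) \<Otimes>\<^sub>M borel)" unfolding G_def by measurable
    have eq: "Z \<omega> * (S (Suc k) \<omega> - S k \<omega>) = G ((Z \<omega>, S k \<omega>), q n \<omega>)" for \<omega>
      unfolding incr G_def n_def by simp
    have [measurable]: "Z \<in> borel_measurable M" by (rule measurable_from_subalg[OF sub Z])
    have [measurable]: "S k \<in> borel_measurable M" for k by (rule measurable_from_subalg[OF sub adapted])
    have "n \<notin> p ` {1..k}"
    proof
      assume "n \<in> p ` {1..k}"
      then obtain j where "j \<in> {1..k}" "p (Suc k) = p j" unfolding n_def by blast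
      then show False using inj_onD[OF p(1), of "Suc k" j] by auto
    qed
    then have ind': "indep_set (sets (F k)) {q n -` B \<inter> space M | B. B \<in> sets borel}"
      unfolding F_def using n p_pos by (intro indep_set_gen_algebra[OF ind]) auto
    show "expectation (\<lambda>\<omega>. Z \<omega> * (S (Suc k) \<omega> - S k \<omega>)) = 0"
      unfolding eq
    proof (rule expectation_conditionally_centred[OF sub _ q[OF n] ind' G])
      show "(\<lambda>\<omega>. (Z \<omega>, S k \<omega>)) \<in> F k \<rightarrow>\<^sub>M borel \<Otimes>\<^sub>M borel"
        by (intro measurable_Pair Z adapted)
      show "integrable M (\<lambda>\<omega>. G ((Z \<omega>, S k \<omega>), q n \<omega>))"
        unfolding eq[symmetric]
        by (rule integrable_const_bound[where B="B * c k"])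
          (use B bd order_trans[OF abs_ge_zero B] in \<open>auto simp: abs_mult intro!: mult_mono\<close>)
      fix y :: "real \<times> real"
      obtain z s where y: "y = (z, s)" by (cases y)
      show "(\<integral>t. G (y, t) \<partial>distr M borel (q n)) = 0"
        using mean_mobius_lift_displacement[OF r[OF n], of "real n * s"]
        by (simp add: y G_def unif[OF n])
    qed
  qed (use sub filt adapted bd in auto)
  have "summable ((\<lambda>m. pi\<^sup>2 * inverse (real m ^ 2)) \<circ> (\<lambda>k. p (Suc k)))"
  proof (rule summable_reindex)
    show "summable (\<lambda>m. pi\<^sup>2 * inverse (real m ^ 2))"
      by (intro summable_mult inverse_power_summable) simp
    show "inj (\<lambda>k. p (Suc k))"
      using p(1) by (auto simp: inj_on_def)
  qed simp
  moreover have "(\<lambda>m. pi\<^sup>2 * inverse (real m ^ 2)) \<circ> (\<lambda>k. p (Suc k)) = (\<lambda>k. (c k)\<^sup>2)"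
    by (simp add: c_def fun_eq_iff power_mult_distrib power_inverse divide_inverse)
  ultimately have "summable (\<lambda>k. (c k)\<^sup>2)" by (simp only:)
  then show ?thesis using AE_convergent by (simp add: S_def)
qed

end

lemma circle_lift_Sigma_comp:
  assumes "\<And>k. p (Suc k) \<ge> 1" "\<And>n. n \<ge> 1 \<Longrightarrow> \<exists>\<rho> \<phi>. \<rho> \<in> {0..1} \<and> w n = rcis \<rho> \<phi>"
  shows "circle_lift (Sigma_comp p w N)"
proof (induction N)
  case 0
  then show ?case by (auto simp: circle_lift_def mono_def id_def)
next
  case (Suc N)
  obtain \<rho> \<phi> where "\<rho> \<in> {0..1}" "w (p (Suc N)) = rcis \<rho> \<phi>" using assms by blast
  then have "circle_lift (Phi (p (Suc N)) (w (p (Suc N))))"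
    using circle_lift_Phi assms(1) by simp
  then show ?case unfolding Sigma_comp.simps using Suc by (rule circle_lift_comp)
qed

theorem theorem5:
  fixes M :: "'w measure"
    and p :: "nat \<Rightarrow> nat"
    and r :: "nat \<Rightarrow> real"
    and q :: "nat \<Rightarrow> 'w \<Rightarrow> real"
    and w :: "nat \<Rightarrow> 'w \<Rightarrow> complex"
  assumes "prob_space M"
    and "bij_betw p {1..} {1..}"
    and "\<And>n. n \<ge> 1 \<Longrightarrow> r n \<in> {0..1}"
    and "prob_space.indep_vars M (\<lambda>_. borel) q {1..}"
    and "\<And>n. n \<ge> 1 \<Longrightarrow> distr M borel (q n) = uniform_measure lborel {0..<2 * pi}"
    and "\<And>n \<omega>. n \<ge> 1 \<Longrightarrow> \<omega> \<in> space M \<Longrightarrow> w n \<omega> = rcis (r n) (q n \<omega>)"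
  shows "AE \<omega> in M. \<exists>!\<mu>. weak_star_limit (\<lambda>N. normalized_deriv (Sigma_comp p (\<lambda>n. w n \<omega>) N)) \<mu>"
proof -
  interpret prob_space M by fact
  have inj: "inj_on p {1..}" and im: "p ` {1..} \<subseteq> {1..}"
    using assms(2) by (auto simp: bij_betw_def)
  then have p1: "p (Suc k) \<ge> 1" for k by auto
  have Sigma_eq: "Sigma_comp p (\<lambda>n. w n \<omega>) N = Sigma_comp p (\<lambda>n. rcis (r n) (q n \<omega>)) N"
    if "\<omega> \<in> space M" for \<omega> N
    by (induction N) (simp_all add: assms(6)[OF p1 that])
  have "AE \<omega> in M. \<forall>m j. convergent
      (\<lambda>N. Sigma_comp p (\<lambda>n. rcis (r n) (q n \<omega>)) N (2 * pi * real j / real m))"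
    unfolding AE_all_countable
    by (intro allI AE_convergent_Sigma_comp inj im assms(3,4,5))
  then show ?thesis
  proof (rule AE_mp, intro AE_I2 impI)
    fix \<omega> assume \<omega>: "\<omega> \<in> space M"
    assume conv: "\<forall>m j. convergent
      (\<lambda>N. Sigma_comp p (\<lambda>n. rcis (r n) (q n \<omega>)) N (2 * pi * real j / real m))"
    show "\<exists>!\<mu>. weak_star_limit (\<lambda>N. normalized_deriv (Sigma_comp p (\<lambda>n. w n \<omega>) N)) \<mu>"
    proof (rule unique_weak_star_limit)
      show "circle_lift (Sigma_comp p (\<lambda>n. w n \<omega>) N)" for N
        using assms(3,6) \<omega> by (intro circle_lift_Sigma_comp p1) blast
      show "convergent (\<lambda>N. Sigma_comp p (\<lambda>n. w n \<omega>) N (2 * pi * real j / real m))" for m j :: nat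
        using conv unfolding Sigma_eq[OF \<omega>] by blast
    qed
  qed
qed

end
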